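(* Let $f\in W_0$ and, for $\lambda\in\Lambda$, let $\gamma^\lambda(f)$ be the coefficients of the $\ell^2$ relaxed Gabor expansion of $f$. Then for every $\lambda\in\Lambda$ $$\gamma^{\lambda}(f) = \int_Q\int_Q \frac{\mathcal{Z}_q f_{\#}(\mathbf{x},\omega)}{\mathcal{Z}_q \mathbf{e}'_\lambda(\mathbf{x},\omega)}\, d^2\mathbf{x}\, d^2\omega,$$ where the quotient denotes $A_\lambda(x_1,\omega_1)^{-1}\, \mathcal{Z}_q f_{\#}(\mathbf{x},\omega)\, B_\lambda(x_2,\omega_2)^{-1}$, with $\mathcal{Z}_q\mathbf{e}'_\lambda(\mathbf{x},\omega) = A_\lambda(x_1,\omega_1) B_\lambda(x_2,\omega_2)$ the factorization defined in the context.
   Context: $\mathbb{H}$ is the algebra of real quaternions with units $i,j,k$; $\exp(it)=\cos t+i\sin t$, $\exp(jt)=\cos t+j\sin t$ for real $t$; $Q=[0,1]^2$ with characteristic function $\mathcal{X}_Q$, and $T_{\mathbf{n}}g(\mathbf{x})=g(\mathbf{x}-\mathbf{n})$. $W_0$ is the space of continuous $f:\mathbb{R}^2\to\mathbb{H}$ with $\|f\|_W=\sum_{\mathbf{n}\in\mathbb{Z}^2}\|f\cdot T_{\mathbf{n}}\mathcal{X}_Q\|_\infty<\infty$. The lattice is $\Lambda=\{(\mathbf{b},\omega):\mathbf{b},\omega\in\mathbb{Z}^2\}$, and $\#$ is the point $\mathbf{b}=\omega=(1/2,1/2)$; $\Lambda^{\#}=\Lambda\cup\{\#\}$. For $\lambda=(\mathbf{p},\theta)\in\Lambda^{\#}$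 put $\mathbf{e}'_\lambda(\mathbf{x})=\exp(2\pi i x_1\theta_1)\exp(-\pi|\mathbf{x}-\mathbf{p}|^2)\exp(2\pi j x_2\theta_2)$, and for $c\in\mathbb{H}$ write $c\,\mathbf{e}'_\lambda(\mathbf{x}) := \exp(2\pi i x_1\theta_1)\,c\,\exp(-\pi|\mathbf{x}-\mathbf{p}|^2)\exp(2\pi j x_2\theta_2)$. The quaternionic Zak transform is $\mathcal{Z}_q f(\mathbf{x},\omega)=\sum_{\mathbf{m}\in\mathbb{Z}^2}\exp(2\pi i m_1\omega_1)f(\mathbf{x}-\mathbf{m})\exp(2\pi j m_2\omega_2)$. With $\Theta_i(0)=\Theta_j(0)=\sum_{m\in\mathbb{Z}}\exp(-\pi m^2)$, the sharp Poisson functional is $\gamma^{\#}(f)=(i\Theta_i(0))^{-1}\mathcal{Z}_qf(\#)(j\Theta_j(0))^{-1}$, where $\mathcal{Z}_qf(\#)$ is the value at $\mathbf{x}=\omega=(1/2,1/2)$. Put $f_{\#}=f-\gamma^{\#}(f)\,\mathbf{e}'_{\#}$. The relaxed Gabor expansion of $f$ is $f=\gamma^{\#}(f)\,\mathbf{e}'_{\#}+\sum_{\lambda\in\Lambda}\gamma^\lambda(f)\,\mathbf{e}'_\lambda$, converging in $L^2(\mathbb{R}^2,\mathbb{H})$, with $(\gamma^\lambda(f))_{\lambda\in\Lambda}\in\ell^2(\Lambda)$. For $\lambda=(\mathbf{p},\theta)$: $A_\lambda(x_1,\omega_1)=\sum_{m\in\mathbb{Z}}\exp(2\pi i m\omega_1)\exp(2\pi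 i\theta_1(x_1-m))\exp(-\pi(x_1-m-p_1)^2)$ (with values in $\mathbb{R}+i\mathbb{R}$) and $B_\lambda(x_2,\omega_2)=\sum_{m\in\mathbb{Z}}\exp(-\pi(x_2-m-p_2)^2)\exp(2\pi j\theta_2(x_2-m))\exp(2\pi j m\omega_2)$ (with values in $\mathbb{R}+j\mathbb{R}$). The integrand is defined almost everywhere. *)

theory Defs
  imports "HOL-Probability.Essential_Supremum"
begin

datatype quat = Quat (qRe: real) (qIm1: real) (qIm2: real) (qIm3: real)

lemma quat_eq_iff:
  "x = y \<longleftrightarrow> qRe x = qRe y \<and> qIm1 x = qIm1 y \<and> qIm2 x = qIm2 y \<and> qIm3 x = qIm3 y"
  by (cases x; cases y) simp

instantiation quat :: real_vector
begin

definition "0 = Quat 0 0 0 0"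
definition "x + y = Quat (qRe x + qRe y) (qIm1 x + qIm1 y) (qIm2 x + qIm2 y) (qIm3 x + qIm3 y)"
definition "- x = Quat (- qRe x) (- qIm1 x) (- qIm2 x) (- qIm3 x)"
definition "x - y = Quat (qRe x - qRe y) (qIm1 x - qIm1 y) (qIm2 x - qIm2 y) (qIm3 x - qIm3 y)"
definition "r *\<^sub>R x = Quat (r * qRe x) (r * qIm1 x) (r * qIm2 x) (r * qIm3 x)"

instance
  by standard
    (simp_all add: zero_quat_def plus_quat_def uminus_quat_def minus_quat_def scaleR_quat_def
       quat_eq_iff algebra_simps)

end

instantiation quat :: real_inner
begin

definition "inner x y = qRe x * qRe y + qIm1 x * qIm1 y + qIm2 x * qIm2 y + qIm3 x * qIm3 y"
definition "norm (x::quat) = sqrt (inner x x)"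
definition "sgn (x::quat) = x /\<^sub>R norm x"
definition "dist (x::quat) y = norm (x - y)"
definition "uniformity = (INF e\<in>{0 <..}. principal {(x::quat, y). dist x y < e})"
definition "open (U::quat set) \<longleftrightarrow> (\<forall>x\<in>U. eventually (\<lambda>(x', y). x' = x \<longrightarrow> y \<in> U) uniformity)"

instance
proof
  fix x :: quat
  show "0 \<le> inner x x"
    by (simp add: inner_quat_def)
  have "inner x x = (qRe x)\<^sup>2 + (qIm1 x)\<^sup>2 + (qIm2 x)\<^sup>2 + (qIm3 x)\<^sup>2"
    by (simp add: inner_quat_def power2_eq_square)
  then show "inner x x = 0 \<longleftrightarrow> x = 0"
    by (simp add: quat_eq_iff zero_quat_def add_nonneg_eq_0_iff)
qed (simp_all add: plus_quat_def scaleR_quat_def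
       inner_quat_def norm_quat_def sgn_quat_def dist_quat_def uniformity_quat_def open_quat_def
       quat_eq_iff algebra_simps)

end

instantiation quat :: real_normed_div_algebra
begin

definition "1 = Quat 1 0 0 0"
definition "x * y = Quat
  (qRe x * qRe y - qIm1 x * qIm1 y - qIm2 x * qIm2 y - qIm3 x * qIm3 y)
  (qRe x * qIm1 y + qIm1 x * qRe y + qIm2 x * qIm3 y - qIm3 x * qIm2 y)
  (qRe x * qIm2 y - qIm1 x * qIm3 y + qIm2 x * qRe y + qIm3 x * qIm1 y)
  (qRe x * qIm3 y + qIm1 x * qIm2 y - qIm2 x * qIm1 y + qIm3 x * qRe y)"
definition "inverse (x::quat) =
  Quat (qRe x) (- qIm1 x) (- qIm2 x) (- qIm3 x) /\<^sub>R (inner x x)"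
definition "x div (y::quat) = x * inverse y"

instance
proof
  fix x y z :: quat and r :: real
  show "x * y * z = x * (y * z)"
    by (simp add: times_quat_def algebra_simps)
  have "inner (x * y) (x * y) = inner x x * inner y y"
    unfolding inner_quat_def times_quat_def quat.sel by algebra
  then show "norm (x * y) = norm x * norm y"
    by (simp add: norm_quat_def real_sqrt_mult)
  show "inverse (0::quat) = 0"
    by (simp add: inverse_quat_def)
  define x' where "x' = Quat (qRe x) (- qIm1 x) (- qIm2 x) (- qIm3 x)"
  have x': "x' * x = Quat (inner x x) 0 0 0" "x * x' = Quat (inner x x) 0 0 0"
    by (simp_all add: x'_def times_quat_def inner_quat_def)
  have "(r *\<^sub>R x') * x = r *\<^sub>R (x' * x)" "x * (r *\<^sub>R x') = r *\<^sub>R (x * x')" for r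
    by (simp_all add: times_quat_def scaleR_quat_def algebra_simps)
  then show "inverse x * x = 1" "x * inverse x = 1" if "x \<noteq> 0"
    using that by (simp_all add: inverse_quat_def one_quat_def scaleR_quat_def x' flip: x'_def)
qed (simp_all add: zero_quat_def one_quat_def plus_quat_def times_quat_def scaleR_quat_def
       divide_quat_def algebra_simps)

end

definition qi :: quat where "qi = Quat 0 1 0 0"
definition qj :: quat where "qj = Quat 0 0 1 0"
definition qk :: quat where "qk = Quat 0 0 0 1"

lemma quat_units:
  "qi * qi = - 1" "qj * qj = - 1" "qk * qk = - 1" "qi * qj = qk" "qj * qi = - qk"
  "qj * qk = qi" "qk * qj = - qi" "qk * qi = qj" "qi * qk = - qj"
  by (simp_all add: qi_def qj_def qk_def times_quat_def one_quat_def uminus_quat_def)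

instantiation quat :: euclidean_space
begin

definition "Basis = {1, qi, qj, qk}"

instance
proof
  show "(Basis :: quat set) \<noteq> {}" "finite (Basis :: quat set)"
    by (simp_all add: Basis_quat_def)
  show "inner u v = (if u = v then 1 else 0)" if "u \<in> Basis" "v \<in> Basis" for u v :: quat
    using that unfolding Basis_quat_def qi_def qj_def qk_def one_quat_def
    by (elim insertE emptyE; hypsubst) (simp_all add: inner_quat_def)
  show "(\<forall>u\<in>Basis. inner x u = 0) \<longleftrightarrow> x = 0" for x :: quat
    by (simp add: Basis_quat_def qi_def qj_def qk_def one_quat_def zero_quat_def inner_quat_def
        quat_eq_iff [of x])
qed

end

definition expi :: "real \<Rightarrow> quat" where
  "expi t = of_real (cos t) + qi * of_real (sin t)"

definition expj :: "real \<Rightarrow> quat" where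
  "expj t = of_real (cos t) + qj * of_real (sin t)"

definition unit_square :: "(real \<times> real) set" where
  "unit_square = {0..1} \<times> {0..1}"

abbreviation Z2 :: "(real \<times> real) set" where
  "Z2 \<equiv> \<int> \<times> \<int>"

definition wiener_norm :: "(real \<times> real \<Rightarrow> quat) \<Rightarrow> ennreal" where
  "wiener_norm f =
     (\<Sum>\<^sub>\<infinity>n\<in>Z2. esssup lborel (\<lambda>x. ennreal (norm (indicator unit_square (x - n) *\<^sub>R f x))))"

definition W0 :: "(real \<times> real \<Rightarrow> quat) set" where
  "W0 = {f. continuous_on UNIV f \<and> wiener_norm f < \<infinity>}"

text \<open>Phase-space points are pairs (position, frequency) of vectors in the plane.\<close>

type_synonym phase_point = "(real \<times> real) \<times> (real \<times> real)"

definition Lattice :: "phase_point set" where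
  "Lattice = Z2 \<times> Z2"

definition sharp :: phase_point where
  "sharp = ((1/2, 1/2), (1/2, 1/2))"

text \<open>\<open>gabor_atom c l\<close> is \<open>c e'\<^sub>l\<close>: the coefficient is inserted between the left and the
  right exponential.\<close>

definition gabor_atom :: "quat \<Rightarrow> phase_point \<Rightarrow> real \<times> real \<Rightarrow> quat" where
  "gabor_atom c l x = (case l of (p, \<theta>) \<Rightarrow>
     expi (2 * pi * fst x * fst \<theta>) * c * of_real (exp (- pi * (norm (x - p))\<^sup>2))
       * expj (2 * pi * snd x * snd \<theta>))"

definition zak :: "(real \<times> real \<Rightarrow> quat) \<Rightarrow> real \<times> real \<Rightarrow> real \<times> real \<Rightarrow> quat" where
  "zak f x \<omega> =
     (\<Sum>\<^sub>\<infinity>m\<in>Z2. expi (2 * pi * fst m * fst \<omega>) * f (x - m) * expj (2 * pi * snd m * snd \<omega>))"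

definition theta0 :: real where
  "theta0 = (\<Sum>\<^sub>\<infinity>m\<in>\<int>. exp (- pi * m\<^sup>2))"

definition gamma_sharp :: "(real \<times> real \<Rightarrow> quat) \<Rightarrow> quat" where
  "gamma_sharp f =
     inverse (qi * of_real theta0) * zak f (fst sharp) (snd sharp) * inverse (qj * of_real theta0)"

definition f_sharp :: "(real \<times> real \<Rightarrow> quat) \<Rightarrow> real \<times> real \<Rightarrow> quat" where
  "f_sharp f x = f x - gabor_atom (gamma_sharp f) sharp x"

text \<open>\<open>\<gamma>\<close> is square-summable and the series converges unconditionally to \<open>f\<close> in the
  \<open>L\<^sup>2\<close>-norm. The nonnegative integral is used since the Bochner integral of a
  non-integrable function is \<open>0\<close>.\<close>

definition relaxed_gabor_expansion :: "(real \<times> real \<Rightarrow> quat) \<Rightarrow> (phase_point \<Rightarrow> quat) \<Rightarrow> bool" where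
  "relaxed_gabor_expansion f \<gamma> \<longleftrightarrow>
     (\<lambda>l. (norm (\<gamma> l))\<^sup>2) summable_on Lattice \<and>
     ((\<lambda>F. \<integral>\<^sup>+x. ennreal ((norm (f x -
          (gabor_atom (gamma_sharp f) sharp x + (\<Sum>l\<in>F. gabor_atom (\<gamma> l) l x))))\<^sup>2) \<partial>lborel)
        \<longlongrightarrow> 0) (finite_subsets_at_top Lattice)"

definition zakA :: "phase_point \<Rightarrow> real \<Rightarrow> real \<Rightarrow> quat" where
  "zakA l x1 \<omega>1 = (case l of (p, \<theta>) \<Rightarrow>
     (\<Sum>\<^sub>\<infinity>m\<in>\<int>. expi (2 * pi * m * \<omega>1) * expi (2 * pi * fst \<theta> * (x1 - m))
        * of_real (exp (- pi * (x1 - m - fst p)\<^sup>2))))"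

definition zakB :: "phase_point \<Rightarrow> real \<Rightarrow> real \<Rightarrow> quat" where
  "zakB l x2 \<omega>2 = (case l of (p, \<theta>) \<Rightarrow>
     (\<Sum>\<^sub>\<infinity>m\<in>\<int>. of_real (exp (- pi * (x2 - m - snd p)\<^sup>2)) * expj (2 * pi * snd \<theta> * (x2 - m))
        * expj (2 * pi * m * \<omega>2)))"

lemma norm_expi [simp]: "norm (expi t) = 1" and norm_expj [simp]: "norm (expj t) = 1"
proof -
  have of_real: "of_real r = Quat r 0 0 0" for r
    by (simp add: of_real_def one_quat_def scaleR_quat_def)
  show "norm (expi t) = 1" "norm (expj t) = 1"
    by (simp_all add: expi_def expj_def of_real qi_def qj_def norm_quat_def inner_quat_def
        plus_quat_def times_quat_def flip: power2_eq_square)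
qed

lemma gaussian_summable: "(\<lambda>m. exp (- pi * (y - m)\<^sup>2)) summable_on (\<int> :: real set)"
proof (rule summable_on_comparison_test)
  have "(\<lambda>n. exp (- real n)) summable_on UNIV"
    using summable_geometric [of "exp (- 1 :: real)"]
    by (intro norm_summable_imp_summable_on) (simp add: exp_of_nat_mult [symmetric])
  then have "(\<lambda>m. exp (- \<bar>m\<bar>)) summable_on range real"
    "(\<lambda>m. exp (- \<bar>m\<bar>)) summable_on range (\<lambda>n. - real n)"
    by (simp_all add: summable_on_reindex inj_on_def o_def)
  then have "(\<lambda>m. exp (- \<bar>m\<bar>)) summable_on (range real \<union> range (\<lambda>n. - real n))"
    by (rule summable_on_union)
  moreover have "(\<int> :: real set) \<subseteq> range real \<union> range (\<lambda>n. - real n)"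
  proof
    fix m :: real assume "m \<in> \<int>"
    then obtain k where "m = of_int k" by (elim Ints_cases)
    then show "m \<in> range real \<union> range (\<lambda>n. - real n)"
      by (cases k rule: int_cases2) auto
  qed
  ultimately have "(\<lambda>m. exp (- \<bar>m\<bar>)) summable_on (\<int> :: real set)"
    by (rule summable_on_subset_banach)
  then show "(\<lambda>m. exp (1 + \<bar>y\<bar>) * exp (- \<bar>m\<bar>)) summable_on (\<int> :: real set)"
    by (rule summable_on_cmult_right)
  fix m :: real
  have "\<bar>y - m\<bar> \<le> 1 + (y - m)\<^sup>2"
    using zero_le_power2 [of "\<bar>y - m\<bar> - 1"] abs_ge_zero [of "y - m"]
    by (simp add: power2_diff [of "\<bar>y - m\<bar>" 1] del: abs_ge_zero)
  also have "(y - m)\<^sup>2 \<le> pi * (y - m)\<^sup>2"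
    using mult_right_mono [of 1 pi "(y - m)\<^sup>2"] pi_gt3 by simp
  finally show "exp (- pi * (y - m)\<^sup>2) \<le> exp (1 + \<bar>y\<bar>) * exp (- \<bar>m\<bar>)"
    unfolding exp_add [symmetric] by simp
qed simp

text \<open>The factorization that justifies reading a quotient by the Zak transform of an atom as a
  two-sided quotient by \<open>zakA\<close> and \<open>zakB\<close>.\<close>

lemma zak_gabor_atom: "zak (gabor_atom c l) x \<omega> = zakA l (fst x) (fst \<omega>) * c * zakB l (snd x) (snd \<omega>)"
proof -
  obtain p \<theta> where l: "l = (p, \<theta>)" by (cases l)
  define a where "a m = expi (2 * pi * m * fst \<omega>) * expi (2 * pi * fst \<theta> * (fst x - m))
    * of_real (exp (- pi * (fst x - m - fst p)\<^sup>2))" for m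
  define b where "b m = of_real (exp (- pi * (snd x - m - snd p)\<^sup>2))
    * expj (2 * pi * snd \<theta> * (snd x - m)) * expj (2 * pi * m * snd \<omega>)" for m
  have a: "(\<lambda>m. norm (a m)) summable_on \<int>"
    using gaussian_summable [of "fst x - fst p"] by (simp add: a_def norm_mult algebra_simps)
  have b: "(\<lambda>m. norm (b m)) summable_on \<int>"
    using gaussian_summable [of "snd x - snd p"] by (simp add: b_def norm_mult algebra_simps)
  have ab: "(\<lambda>z. norm (case z of (m, n) \<Rightarrow> a m * c * b n)) summable_on \<int> \<times> \<int>"
  proof (rule iffD2 [OF Infinite_Sum.abs_summable_on_Sigma_iff], intro conjI ballI)
    fix m :: real
    show "(\<lambda>n. norm (case (m, n) of (m, n) \<Rightarrow> a m * c * b n)) summable_on \<int>"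
      using summable_on_cmult_right [OF b, of "norm (a m * c)"] by (simp add: norm_mult)
  next
    have "(\<Sum>\<^sub>\<infinity>n\<in>\<int>. norm (case (m, n) of (m, n) \<Rightarrow> a m * c * b n))
        = norm (a m) * (norm c * (\<Sum>\<^sub>\<infinity>n\<in>\<int>. norm (b n)))" for m
      by (simp add: norm_mult infsum_cmult_right' mult.assoc)
    then show "(\<lambda>m. norm (\<Sum>\<^sub>\<infinity>n\<in>\<int>. norm (case (m, n) of (m, n) \<Rightarrow> a m * c * b n))) summable_on \<int>"
      using summable_on_cmult_left [OF a, of "norm c * (\<Sum>\<^sub>\<infinity>n\<in>\<int>. norm (b n))"]
      by (simp add: infsum_nonneg)
  qed
  have gauss: "of_real (exp (- pi * (norm (x - m - p))\<^sup>2)) =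
      (of_real (exp (- pi * (fst x - fst m - fst p)\<^sup>2)) * of_real (exp (- pi * (snd x - snd m - snd p)\<^sup>2)) :: quat)" for m
    by (simp add: norm_prod_def exp_add [symmetric] algebra_simps flip: of_real_mult)
  have comm: "of_real r * y = y * of_real r" for r and y :: quat
    by (rule Real_Vector_Spaces.of_real_def [THEN ssubst]) simp
  have "zak (gabor_atom c l) x \<omega> = (\<Sum>\<^sub>\<infinity>(m, n)\<in>\<int> \<times> \<int>. a m * c * b n)"
    unfolding zak_def
  proof (rule infsum_cong)
    fix m :: "real \<times> real"
    show "expi (2 * pi * fst m * fst \<omega>) * gabor_atom c l (x - m) * expj (2 * pi * snd m * snd \<omega>) =
        (case m of (m, n) \<Rightarrow> a m * c * b n)"
      by (simp add: gabor_atom_def l a_def b_def gauss [simplified] split_beta mult.assoc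
          comm [of _ c] comm [of _ "c * z" for z] mult.commute [of "fst \<theta>"] mult.commute [of "snd \<theta>"])
  qed
  also have "\<dots> = (\<Sum>\<^sub>\<infinity>m\<in>\<int>. \<Sum>\<^sub>\<infinity>n\<in>\<int>. a m * c * b n)"
    using infsum_Sigma_banach [OF abs_summable_summable [OF ab]] by simp
  also have "\<dots> = (\<Sum>\<^sub>\<infinity>m\<in>\<int>. a m) * c * (\<Sum>\<^sub>\<infinity>n\<in>\<int>. b n)"
    using abs_summable_summable [OF a] abs_summable_summable [OF b]
    by (simp only: infsum_cmult_right infsum_cmult_left summable_on_cmult_left)
  finally show ?thesis
    by (simp add: zakA_def zakB_def l a_def b_def)
qed

text \<open>The two-sided quotient of \<open>zak f\<close> by \<open>zak e'\<^sub>l = A\<^sub>l B\<^sub>l\<close>.\<close>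

definition zak_quotient ::
    "(real \<times> real \<Rightarrow> quat) \<Rightarrow> phase_point \<Rightarrow> real \<times> real \<Rightarrow> real \<times> real \<Rightarrow> quat" where
  "zak_quotient f l x \<omega> =
     inverse (zakA l (fst x) (fst \<omega>)) * zak f x \<omega> * inverse (zakB l (snd x) (snd \<omega>))"

end

theory Submission
  imports Defs "HOL-Complex_Analysis.Conformal_Mappings"
begin

text \<open>Write \<open>A\<close> and \<open>B\<close> for the two factors of the Zak transform of the Gaussian at the origin. Moving to a
lattice point \<open>l\<close> only multiplies them by characters, \<open>A\<^sub>l = A \<alpha>\<^sub>l\<close> and \<open>B\<^sub>l = \<beta>\<^sub>l B\<close> with
\<open>\<alpha>\<^sub>l\<close> on the circle through \<open>i\<close> and \<open>\<beta>\<^sub>l\<close> on the circle through \<open>j\<close> (\<open>zakA_lattice\<close>, \<open>zakB_lattice\<close>).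
Dividing the Zak transform of \<open>f\<^sub># = \<Sum> \<gamma>\<^sub>l e'\<^sub>l\<close> by \<open>A\<close> and \<open>B\<close> therefore turns the expansion into a
two-sided quaternionic Fourier series

  \<open>H = A\<^sup>-\<^sup>1 (Z f\<^sub>#) B\<^sup>-\<^sup>1 = \<Sum> \<alpha>\<^sub>l \<gamma>\<^sub>l \<beta>\<^sub>l\<close>,

and the claimed formula reads off one of its Fourier coefficients, since the quotient for \<open>l\<close> is
\<open>\<alpha>\<^sub>l\<^sup>-\<^sup>1 H \<beta>\<^sub>l\<^sup>-\<^sup>1\<close>.

Four facts make this rigorous. The characters \<open>c \<mapsto> \<alpha>\<^sub>l c \<beta>\<^sub>l\<close> are orthonormal
on the product of two unit squares (\<open>Parseval_phase_space\<close>). The Zak transform does not increase the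
\<open>L\<^sup>2\<close>-norm (\<open>zak_norm_le\<close>), so the convergence of the Gabor expansion gives
\<open>\<parallel>A (H - G\<^sub>F) B\<parallel> \<rightarrow> 0\<close> for the finite partial sums \<open>G\<^sub>F\<close>. For fixed \<open>x\<close>, the
function \<open>A\<close> is the restriction to the real line of an entire function of \<open>\<omega>\<close> that is positive at
\<open>\<omega> = 0\<close>, so its zeros are countable and \<open>A\<close> and \<open>B\<close> are nonzero almost everywhere
(\<open>AE_window_nonzero\<close>).

The weight \<open>\<bar>A\<bar> \<bar>B\<bar>\<close> is not bounded below, so convergence with the weight does not by itself give
convergence without it. It does give \<open>G\<^sub>F \<rightarrow> H\<close> almost everywhere along a sequence. The partial sums are Cauchy in
\<open>L\<^sup>2\<close> because \<open>\<gamma>\<close> is square-summable, so by Fatou \<open>G\<^sub>F \<rightarrow> H\<close> also in \<open>L\<^sup>2\<close>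
(\<open>Fourier_coefficient_from_weighted_convergence\<close>). In particular \<open>H\<close> is integrable, which is how
the singularities of the quotient at the zeros of \<open>A\<close> and \<open>B\<close> are controlled.\<close>

section \<open>Quaternionic exponentials\<close>

lemma of_real_quat: "of_real r = Quat r 0 0 0"
  by (simp add: of_real_def one_quat_def scaleR_quat_def)

lemmas quat_component_defs =
  plus_quat_def minus_quat_def uminus_quat_def times_quat_def scaleR_quat_def zero_quat_def
  one_quat_def inner_quat_def qi_def qj_def of_real_quat

lemma expi_Quat: "expi t = Quat (cos t) (sin t) 0 0"
  by (simp add: expi_def quat_component_defs)

lemma expj_Quat: "expj t = Quat (cos t) 0 (sin t) 0"
  by (simp add: expj_def quat_component_defs)

lemma expi_0 [simp]: "expi 0 = 1" and expj_0 [simp]: "expj 0 = 1"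
  by (simp_all add: expi_def expj_def)

lemma expi_add: "expi (s + t) = expi s * expi t"
  and expj_add: "expj (s + t) = expj s * expj t"
  by (simp_all add: expi_Quat expj_Quat times_quat_def cos_add sin_add algebra_simps)

lemma expi_nonzero [simp]: "expi t \<noteq> 0" and expj_nonzero [simp]: "expj t \<noteq> 0"
  by (metis norm_expi norm_zero zero_neq_one, metis norm_expj norm_zero zero_neq_one)

lemma inverse_expi: "inverse (expi t) = expi (- t)" and inverse_expj: "inverse (expj t) = expj (- t)"
  by (rule inverse_unique, simp flip: expi_add, rule inverse_unique, simp flip: expj_add)

lemma expi_int [simp]: "n \<in> \<int> \<Longrightarrow> expi (2 * pi * n) = 1"
  and expj_int [simp]: "n \<in> \<int> \<Longrightarrow> expj (2 * pi * n) = 1"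
  by (simp_all add: expi_Quat expj_Quat one_quat_def cos_integer_2pi sin_integer_2pi)

lemma continuous_on_expi [continuous_intros]:
  fixes S :: "'a::t2_space set"
  shows "continuous_on S g \<Longrightarrow> continuous_on S (\<lambda>x. expi (g x))"
  and continuous_on_expj [continuous_intros]:
  "continuous_on S g \<Longrightarrow> continuous_on S (\<lambda>x. expj (g x))"
  unfolding expi_def expj_def by (auto intro!: continuous_intros)

text \<open>The two-sided products \<open>\<alpha> c \<beta>\<close> with unit \<open>\<alpha>\<close>, \<open>\<beta>\<close> are isometries of \<open>c\<close>, so the unit factors of one
argument can be moved to the other. This reduces every inner product of two characters to the mean
of a single character.\<close>

lemma inner_characters:
  "inner (expi a * c * expj b) (expi a' * c' * expj b') = inner (expi (a - a') * c * expj (b - b')) c'"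
  by (cases c; cases c')
    (simp add: expi_Quat expj_Quat times_quat_def inner_quat_def cos_diff sin_diff algebra_simps)

lemma borel_measurable_expi [measurable]: "expi \<in> borel_measurable borel"
  and borel_measurable_expj [measurable]: "expj \<in> borel_measurable borel"
  by (intro borel_measurable_continuous_onI continuous_intros)+

lemma expi_mult: "expi t * c = cos t *\<^sub>R c + sin t *\<^sub>R (qi * c)"
  and mult_expj: "c * expj t = cos t *\<^sub>R c + sin t *\<^sub>R (c * qj)"
  by (cases c; simp add: expi_Quat expj_Quat quat_component_defs)+

section \<open>Two-sided characters and Parseval's identity\<close>

lemma cos_sin_period_integral:
  assumes "a \<in> \<int>"
  shows "((\<lambda>t. cos (2 * pi * a * t)) has_integral (if a = 0 then 1 else 0)) {0..1}"
    and "((\<lambda>t. sin (2 * pi * a * t)) has_integral 0) {0..1}"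
proof -
  show "((\<lambda>t. cos (2 * pi * a * t)) has_integral (if a = 0 then 1 else 0)) {0..1}"
  proof (cases "a = 0")
    case True
    then show ?thesis using has_integral_const_real[of "1::real" 0 1] by simp
  next
    case False
    have "((\<lambda>t. cos (2 * pi * a * t)) has_integral
       sin (2 * pi * a * 1) / (2 * pi * a) - sin (2 * pi * a * 0) / (2 * pi * a)) {0..1}"
      using False
      by (intro fundamental_theorem_of_calculus)
        (auto intro!: derivative_eq_intros simp flip: has_real_derivative_iff_has_vector_derivative)
    then show ?thesis using False assms by (simp add: sin_integer_2pi)
  qed
  show "((\<lambda>t. sin (2 * pi * a * t)) has_integral 0) {0..1}"
  proof (cases "a = 0")
    case False
    have "((\<lambda>t. sin (2 * pi * a * t)) has_integral
       - cos (2 * pi * a * 1) / (2 * pi * a) - - cos (2 * pi * a * 0) / (2 * pi * a)) {0..1}"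
      using False
      by (intro fundamental_theorem_of_calculus)
        (auto intro!: derivative_eq_intros simp flip: has_real_derivative_iff_has_vector_derivative)
    then show ?thesis using False assms by (simp add: cos_integer_2pi)
  qed simp
qed

lemma expi_period_integral:
  assumes "a \<in> \<int>"
  shows "((\<lambda>t. expi (2 * pi * a * t) * c) has_integral (if a = 0 then c else 0)) {0..1}"
proof -
  have "((\<lambda>t. cos (2 * pi * a * t) *\<^sub>R c + sin (2 * pi * a * t) *\<^sub>R (qi * c)) has_integral
      (if a = 0 then 1 else 0) *\<^sub>R c + 0 *\<^sub>R (qi * c)) {0..1}"
    by (intro has_integral_add has_integral_scaleR_left cos_sin_period_integral assms)
  then show ?thesis
    by (simp add: expi_mult split: if_splits)
qed

lemma expj_period_integral:
  assumes "a \<in> \<int>"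
  shows "((\<lambda>t. c * expj (2 * pi * a * t)) has_integral (if a = 0 then c else 0)) {0..1}"
proof -
  have "((\<lambda>t. cos (2 * pi * a * t) *\<^sub>R c + sin (2 * pi * a * t) *\<^sub>R (c * qj)) has_integral
      (if a = 0 then 1 else 0) *\<^sub>R c + 0 *\<^sub>R (c * qj)) {0..1}"
    by (intro has_integral_add has_integral_scaleR_left cos_sin_period_integral assms)
  then show ?thesis
    by (simp add: mult_expj split: if_splits)
qed

lemma unit_square_cbox: "unit_square = cbox (0, 0) (1, 1)"
  by (simp add: unit_square_def cbox_Pair_eq)

lemma unit_square_borel [measurable, simp]: "unit_square \<in> sets borel"
  by (simp add: unit_square_cbox borel_compact)

abbreviation phase_square :: "phase_point set" where
  "phase_square \<equiv> unit_square \<times> unit_square"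

lemma phase_square_cbox: "phase_square = cbox ((0, 0), (0, 0)) ((1, 1), (1, 1))"
  by (simp add: unit_square_cbox cbox_Pair_eq)

lemma phase_square_borel [measurable, simp]: "phase_square \<in> sets borel"
  unfolding phase_square_cbox by (rule borel_compact) simp

lemma has_bochner_integral_compact:
  fixes f :: "'a::euclidean_space \<Rightarrow> 'b::euclidean_space"
  assumes "compact K" "continuous_on K f"
  shows "has_bochner_integral (restrict_space lborel K) f (integral K f)"
proof -
  have *: "set_integrable lborel K f"
    unfolding set_integrable_def by (rule borel_integrable_compact[OF assms])
  have "K \<in> sets lborel" using assms by (simp add: borel_compact)
  then show ?thesis
    using * set_borel_integral_eq_integral(2)[OF *]
    by (simp add: has_bochner_integral_iff integrable_restrict_space integral_restrict_space
        set_integrable_def set_lebesgue_integral_def)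
qed

lemma character_integral_square:
  assumes "a \<in> \<int>" "b \<in> \<int>"
  shows "integral unit_square (\<lambda>y. expi (2 * pi * a * fst y) * c * expj (2 * pi * b * snd y))
    = (if a = 0 \<and> b = 0 then c else 0)"
proof -
  have "integral unit_square (\<lambda>y. expi (2 * pi * a * fst y) * c * expj (2 * pi * b * snd y))
    = integral (cbox 0 1) (\<lambda>s. integral (cbox 0 1)
        (\<lambda>t. expi (2 * pi * a * fst (s, t)) * c * expj (2 * pi * b * snd (s, t))))"
    unfolding unit_square_cbox by (intro integral_prod_continuous continuous_intros)
  also have "\<dots> = integral {0..1} (\<lambda>s. if b = 0 then expi (2 * pi * a * s) * c else 0)"
    using integral_unique[OF expj_period_integral[OF assms(2)]] by simp
  also have "\<dots> = (if a = 0 \<and> b = 0 then c else 0)"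
    using integral_unique[OF expi_period_integral[OF assms(1)]] by (cases "b = 0") simp_all
  finally show ?thesis .
qed

text \<open>For \<open>l = (p, \<theta>)\<close> and \<open>z = (x, \<omega>)\<close> the phase \<open>2\<pi>(\<theta>\<^sub>1 x\<^sub>1 - p\<^sub>1 \<omega>\<^sub>1)\<close> is the argument of \<open>A\<^sub>l / A\<close>, and
\<open>phase_j\<close>, which uses the second coordinates, is the argument of \<open>B\<^sub>l / B\<close>.\<close>

definition phase_i :: "phase_point \<Rightarrow> phase_point \<Rightarrow> real" where
  "phase_i l z = 2 * pi * (fst (snd l) * fst (fst z) - fst (fst l) * fst (snd z))"

definition phase_j :: "phase_point \<Rightarrow> phase_point \<Rightarrow> real" where
  "phase_j l z = 2 * pi * (snd (snd l) * snd (fst z) - snd (fst l) * snd (snd z))"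

lemma phase_diff:
  "phase_i l z - phase_i k z = phase_i (l - k) z" "phase_j l z - phase_j k z = phase_j (l - k) z"
  by (simp_all add: phase_i_def phase_j_def algebra_simps)

lemma Lattice_diff: "l \<in> Lattice \<Longrightarrow> k \<in> Lattice \<Longrightarrow> l - k \<in> Lattice"
  by (auto simp: Lattice_def)

lemma continuous_on_phase [continuous_intros]:
  "continuous_on S (phase_i l)" "continuous_on S (phase_j l)"
  unfolding phase_i_def phase_j_def by (intro continuous_intros)+

lemma measurable_phase [measurable]: "phase_i l \<in> borel_measurable borel" "phase_j l \<in> borel_measurable borel"
  by (intro borel_measurable_continuous_onI continuous_intros)+

lemma character_integral_phase_space:
  assumes "l \<in> Lattice"
  shows "integral phase_square (\<lambda>z. expi (phase_i l z) * c * expj (phase_j l z))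
    = (if l = 0 then c else 0)"
proof -
  obtain p1 p2 t1 t2 where l: "l = ((p1, p2), (t1, t2))" by (metis prod.exhaust)
  have Z: "p1 \<in> \<int>" "p2 \<in> \<int>" "t1 \<in> \<int>" "t2 \<in> \<int>"
    using assms by (auto simp: Lattice_def l)
  have "integral phase_square (\<lambda>z. expi (phase_i l z) * c * expj (phase_j l z))
      = integral unit_square (\<lambda>x. integral unit_square
          (\<lambda>w. expi (phase_i l (x, w)) * c * expj (phase_j l (x, w))))"
    by (simp only: phase_square_cbox, unfold unit_square_cbox)
      (intro integral_prod_continuous continuous_intros)
  also have "\<dots> = integral unit_square (\<lambda>x. integral unit_square
          (\<lambda>w. expi (2 * pi * (- p1) * fst w) * (expi (2 * pi * t1 * fst x) * c * expj (2 * pi * t2 * snd x))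
             * expj (2 * pi * (- p2) * snd w)))"
  proof (intro integral_cong)
    fix x w :: "real \<times> real"
    have "phase_i l (x, w) = 2 * pi * (- p1) * fst w + 2 * pi * t1 * fst x"
      "phase_j l (x, w) = 2 * pi * t2 * snd x + 2 * pi * (- p2) * snd w"
      by (simp_all add: phase_i_def phase_j_def l algebra_simps)
    then show "expi (phase_i l (x, w)) * c * expj (phase_j l (x, w)) =
      expi (2 * pi * (- p1) * fst w) * (expi (2 * pi * t1 * fst x) * c * expj (2 * pi * t2 * snd x))
        * expj (2 * pi * (- p2) * snd w)"
      by (simp only: expi_add expj_add mult.assoc)
  qed
  also have "\<dots> = integral unit_square
      (\<lambda>x. if p1 = 0 \<and> p2 = 0 then expi (2 * pi * t1 * fst x) * c * expj (2 * pi * t2 * snd x) else 0)"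
    using Z by (subst character_integral_square) auto
  also have "\<dots> = (if l = 0 then c else 0)"
    using Z character_integral_square[of t1 t2 c] by (cases "p1 = 0 \<and> p2 = 0") (auto simp: l zero_prod_def)
  finally show ?thesis .
qed

text \<open>The same computation is needed on the square, in the variable \<open>\<omega>\<close> alone, and on the
product of two squares, so the orthogonality relation is a hypothesis here. It is required for
every \<open>c\<close> because a quaternion between the two exponentials cannot be pulled out of the integral.\<close>

lemma Parseval_characters:
  fixes \<alpha> \<beta> :: "'l \<Rightarrow> 'a::euclidean_space \<Rightarrow> real" and c :: "'l \<Rightarrow> quat"
  assumes "finite F" "compact K"
    and cont: "\<And>l. l \<in> F \<Longrightarrow> continuous_on K (\<alpha> l)" "\<And>l. l \<in> F \<Longrightarrow> continuous_on K (\<beta> l)"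
    and orth: "\<And>l k c. l \<in> F \<Longrightarrow> k \<in> F \<Longrightarrow>
      integral K (\<lambda>z. expi (\<alpha> l z - \<alpha> k z) * c * expj (\<beta> l z - \<beta> k z)) = (if l = k then c else 0)"
  shows "(\<integral>\<^sup>+z\<in>K. ennreal ((norm (\<Sum>l\<in>F. expi (\<alpha> l z) * c l * expj (\<beta> l z)))\<^sup>2) \<partial>lborel)
    = ennreal (\<Sum>l\<in>F. (norm (c l))\<^sup>2)"
proof -
  let ?M = "restrict_space lborel K"
  have "has_bochner_integral ?M (\<lambda>z. \<Sum>l\<in>F. \<Sum>k\<in>F.
      inner (expi (\<alpha> l z - \<alpha> k z) * c l * expj (\<beta> l z - \<beta> k z)) (c k))
    (\<Sum>l\<in>F. \<Sum>k\<in>F. inner (if l = k then c l else 0) (c k))"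
  proof (intro has_bochner_integral_sum has_bochner_integral_inner_left)
    fix l k assume lk: "l \<in> F" "k \<in> F"
    show "has_bochner_integral ?M (\<lambda>z. expi (\<alpha> l z - \<alpha> k z) * c l * expj (\<beta> l z - \<beta> k z))
       (if l = k then c l else 0)"
      using has_bochner_integral_compact[OF assms(2), of "\<lambda>z. expi (\<alpha> l z - \<alpha> k z) * c l * expj (\<beta> l z - \<beta> k z)"]
        orth[OF lk, of "c l"] lk
      by (simp add: continuous_intros cont)
  qed
  also have "(\<Sum>l\<in>F. \<Sum>k\<in>F. inner (if l = k then c l else 0) (c k)) = (\<Sum>l\<in>F. (norm (c l))\<^sup>2)"
    using assms(1) by (intro sum.cong refl)
      (simp add: power2_norm_eq_inner if_distrib[of "\<lambda>x. inner x _"] sum.delta cong: if_cong)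
  also have "(\<lambda>z. \<Sum>l\<in>F. \<Sum>k\<in>F. inner (expi (\<alpha> l z - \<alpha> k z) * c l * expj (\<beta> l z - \<beta> k z)) (c k))
      = (\<lambda>z. (norm (\<Sum>l\<in>F. expi (\<alpha> l z) * c l * expj (\<beta> l z)))\<^sup>2)"
    unfolding power2_norm_eq_inner inner_sum_left unfolding inner_sum_right inner_characters ..
  finally have *: "has_bochner_integral ?M (\<lambda>z. (norm (\<Sum>l\<in>F. expi (\<alpha> l z) * c l * expj (\<beta> l z)))\<^sup>2)
    (\<Sum>l\<in>F. (norm (c l))\<^sup>2)" .
  have "K \<in> sets lborel" using assms by (simp add: borel_compact)
  then show ?thesis
    using nn_integral_eq_integral[of ?M "\<lambda>z. (norm (\<Sum>l\<in>F. expi (\<alpha> l z) * c l * expj (\<beta> l z)))\<^sup>2"] *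
    by (simp add: has_bochner_integral_iff nn_integral_restrict_space)
qed

lemma Parseval_phase_space:
  assumes "finite F" "F \<subseteq> Lattice"
  shows "(\<integral>\<^sup>+z\<in>phase_square.
      ennreal ((norm (\<Sum>l\<in>F. expi (phase_i l z) * c l * expj (phase_j l z)))\<^sup>2) \<partial>lborel)
    = ennreal (\<Sum>l\<in>F. (norm (c l))\<^sup>2)"
proof (rule Parseval_characters[OF assms(1)])
  fix l k :: phase_point and c :: quat assume "l \<in> F" "k \<in> F"
  then show "integral phase_square (\<lambda>z. expi (phase_i l z - phase_i k z) * c * expj (phase_j l z - phase_j k z))
    = (if l = k then c else 0)"
    unfolding phase_diff using assms
    by (subst character_integral_phase_space) (auto intro: Lattice_diff)
qed (simp_all add: phase_square_cbox continuous_intros)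

lemma Parseval_square:
  assumes "finite F" "F \<subseteq> Z2"
  shows "(\<integral>\<^sup>+w\<in>unit_square. ennreal ((norm (\<Sum>m\<in>F.
      expi (2 * pi * fst m * fst w) * c m * expj (2 * pi * snd m * snd w)))\<^sup>2) \<partial>lborel)
    = ennreal (\<Sum>m\<in>F. (norm (c m))\<^sup>2)"
proof (rule Parseval_characters[OF assms(1)])
  fix l k :: "real \<times> real" and c :: quat assume lk: "l \<in> F" "k \<in> F"
  have "integral unit_square (\<lambda>z. expi (2 * pi * (fst l - fst k) * fst z) * c * expj (2 * pi * (snd l - snd k) * snd z))
    = (if l = k then c else 0)"
    using lk by (subst character_integral_square) (auto simp: prod_eq_iff dest!: subsetD[OF assms(2)])
  then show "integral unit_square (\<lambda>z. expi (2 * pi * fst l * fst z - 2 * pi * fst k * fst z) * c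
       * expj (2 * pi * snd l * snd z - 2 * pi * snd k * snd z))
    = (if l = k then c else 0)"
    by (simp add: algebra_simps)
qed (simp_all add: unit_square_cbox continuous_intros)

section \<open>The Zak transform does not increase the norm\<close>

lemma countable_Ints_real: "countable (\<int> :: real set)" and infinite_Ints_real: "infinite (\<int> :: real set)"
  by (auto simp: Ints_def infinite_UNIV_char_0 finite_image_iff inj_on_def)

lemma countable_Z2: "countable Z2" and infinite_Z2: "infinite Z2"
  using countable_Ints_real infinite_Ints_real Ints_0 by (auto simp: finite_cartesian_product_iff)

lemma partial_sums_tendsto_infsum:
  fixes u :: "'m \<Rightarrow> 'b::{comm_monoid_add, t2_space}"
  assumes "countable X" "infinite X" "u summable_on X"
  shows "(\<lambda>n. \<Sum>m\<in>from_nat_into X ` {..<n}. u m) \<longlonglongrightarrow> infsum u X"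
proof -
  have bij: "bij_betw (from_nat_into X) UNIV X"
    using assms by (simp add: bij_betw_from_nat_into)
  then have "((\<lambda>k. u (from_nat_into X k)) has_sum infsum u X) UNIV"
    using has_sum_infsum[OF assms(3)] by (subst has_sum_reindex_bij_betw)
  then have "(\<lambda>k. u (from_nat_into X k)) sums infsum u X"
    by (rule has_sum_imp_sums)
  moreover have "(\<Sum>m\<in>from_nat_into X ` {..<n}. u m) = (\<Sum>k<n. u (from_nat_into X k))" for n
    using bij by (subst sum.reindex) (auto simp: bij_betw_def inj_on_def)
  ultimately show ?thesis by (simp add: sums_def)
qed

lemma borel_measurable_infsum_countable:
  fixes u :: "'m \<Rightarrow> 'a \<Rightarrow> 'b::euclidean_space"
  assumes "countable X" "infinite X"
    and [measurable]: "\<And>m. u m \<in> borel_measurable M"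
    and "\<And>z. (\<lambda>m. u m z) summable_on X"
  shows "(\<lambda>z. \<Sum>\<^sub>\<infinity>m\<in>X. u m z) \<in> borel_measurable M"
proof (rule borel_measurable_LIMSEQ_metric)
  show "(\<lambda>n. \<Sum>m\<in>from_nat_into X ` {..<n}. u m z) \<longlonglongrightarrow> (\<Sum>\<^sub>\<infinity>m\<in>X. u m z)" for z
    by (rule partial_sums_tendsto_infsum[OF assms(1,2,4)])
qed measurable

text \<open>Parseval for the partial sums along an enumeration, and Fatou for their limit. Where the
infinite sum does not converge it is \<open>0\<close> by convention.\<close>

lemma zak_fibre_norm_le:
  "(\<integral>\<^sup>+w\<in>unit_square. ennreal ((norm (zak g x w))\<^sup>2) \<partial>lborel)
    \<le> (\<Sum>k. ennreal ((norm (g (x - from_nat_into Z2 k)))\<^sup>2))"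
proof -
  define e where "e = from_nat_into Z2"
  have inj: "inj e" and e: "range e \<subseteq> Z2"
    using bij_betw_from_nat_into[OF countable_Z2 infinite_Z2] by (auto simp: e_def bij_betw_def)
  define u where "u m w = expi (2 * pi * fst m * fst w) * g (x - m) * expj (2 * pi * snd m * snd w)"
    for m w :: "real \<times> real"
  have um: "(\<lambda>w. ennreal ((norm (\<Sum>m\<in>e ` {..<n}. u m w))\<^sup>2) * indicator unit_square w) \<in> borel_measurable lborel" for n
  proof -
    have "continuous_on UNIV (u m)" for m unfolding u_def by (intro continuous_intros)
    then have [measurable]: "u m \<in> borel_measurable borel" for m
      by (rule borel_measurable_continuous_onI)
    show ?thesis by measurable
  qed
  have "ennreal ((norm (zak g x w))\<^sup>2)
      \<le> liminf (\<lambda>n. ennreal ((norm (\<Sum>m\<in>e ` {..<n}. u m w))\<^sup>2))" for w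
  proof (cases "(\<lambda>m. u m w) summable_on Z2")
    case True
    have "(\<lambda>n. ennreal ((norm (\<Sum>m\<in>e ` {..<n}. u m w))\<^sup>2)) \<longlonglongrightarrow> ennreal ((norm (zak g x w))\<^sup>2)"
      using partial_sums_tendsto_infsum[OF countable_Z2 infinite_Z2 True]
      by (intro tendsto_ennrealI tendsto_power tendsto_norm) (simp add: zak_def u_def e_def)
    from lim_imp_Liminf[OF sequentially_bot this] show ?thesis by simp
  next
    case False
    then show ?thesis by (simp add: zak_def u_def infsum_not_exists)
  qed
  then have "(\<integral>\<^sup>+w\<in>unit_square. ennreal ((norm (zak g x w))\<^sup>2) \<partial>lborel)
      \<le> (\<integral>\<^sup>+w. liminf (\<lambda>n. ennreal ((norm (\<Sum>m\<in>e ` {..<n}. u m w))\<^sup>2) * indicator unit_square w) \<partial>lborel)"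
    by (intro nn_integral_mono) (auto simp: indicator_def)
  also have "\<dots> \<le> liminf (\<lambda>n. \<integral>\<^sup>+w\<in>unit_square. ennreal ((norm (\<Sum>m\<in>e ` {..<n}. u m w))\<^sup>2) \<partial>lborel)"
    by (rule nn_integral_liminf[OF um])
  also have "\<dots> = liminf (\<lambda>n. \<Sum>k<n. ennreal ((norm (g (x - e k)))\<^sup>2))"
    unfolding u_def using e inj
    by (subst Parseval_square) (auto simp: sum.reindex inj_on_subset sum_ennreal)
  also have "\<dots> = (\<Sum>k. ennreal ((norm (g (x - e k)))\<^sup>2))"
    using summable_sums[OF summableI[of "\<lambda>k. ennreal ((norm (g (x - e k)))\<^sup>2)"]]
    by (simp add: sums_def lim_imp_Liminf)
  finally show ?thesis by (simp add: e_def)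
qed

text \<open>Open tiles are used because the closed unit squares overlap along the grid lines. The open tiles miss
a null set, and an upper bound is all that is needed.\<close>

lemma sum_indicator_translates_le_1:
  "(\<Sum>k. indicator (box (0, 0) (1, 1)) (y + from_nat_into Z2 k)) \<le> (1 :: ennreal)"
proof -
  define e where "e = from_nat_into Z2"
  have inj: "inj e" and e: "e k \<in> Z2" for k
    using bij_betw_from_nat_into[OF countable_Z2 infinite_Z2] by (auto simp: e_def bij_betw_def)
  define A where "A k = {y. y + e k \<in> box (0, 0) (1, 1)}" for k
  have "disjoint_family A"
  proof (clarsimp simp: disjoint_family_on_def A_def disjoint_iff)
    fix k j :: nat and s t :: real
    assume *: "k \<noteq> j" "(s, t) + e k \<in> box (0, 0) (1, 1)" "(s, t) + e j \<in> box (0, 0) (1, 1)"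
    obtain a b where k: "e k = (of_int a, of_int b)"
      using e[of k] by (metis mem_Times_iff Ints_cases prod.collapse)
    obtain a' b' where j: "e j = (of_int a', of_int b')"
      using e[of j] by (metis mem_Times_iff Ints_cases prod.collapse)
    from * k j have "\<bar>real_of_int a - real_of_int a'\<bar> < 1" "\<bar>real_of_int b - real_of_int b'\<bar> < 1"
      by (auto simp: mem_box Basis_prod_def)
    then have "a = a'" "b = b'" by linarith+
    with k j have "e k = e j" by simp
    with inj * show False by (simp add: inj_eq)
  qed
  then have "(\<Sum>k. indicator (A k) y) = (indicator (\<Union>k. A k) y :: ennreal)"
    by (rule suminf_indicator)
  also have "\<dots> \<le> 1" by (auto simp: indicator_def)
  finally show ?thesis by (simp add: A_def e_def indicator_def)
qed

lemma nn_integral_lborel_translate: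
  fixes F :: "'a::euclidean_space \<Rightarrow> ennreal"
  assumes [measurable]: "F \<in> borel_measurable borel"
  shows "(\<integral>\<^sup>+x. F x \<partial>lborel) = (\<integral>\<^sup>+x. F (c + x) \<partial>lborel)"
  by (subst lborel_distr_plus[of c, symmetric], subst nn_integral_distr) auto

lemma AE_unit_square_iff_box: "AE x in lborel. x \<in> unit_square \<longleftrightarrow> x \<in> box (0, 0) (1, 1)"
proof -
  have "emeasure lborel (unit_square - box (0, 0) (1, 1)) = 0"
    unfolding unit_square_def cbox_interval[symmetric] cbox_Pair_eq[symmetric]
    by (subst emeasure_Diff) (auto simp: box_subset_cbox emeasure_lborel_box_eq emeasure_lborel_cbox_eq)
  then have "AE x in lborel. x \<notin> unit_square - box (0, 0) (1, 1)"
    by (intro AE_not_in null_setsI) auto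
  then show ?thesis
    by eventually_elim (use box_subset_cbox[of "(0, 0)" "(1, 1) :: real \<times> real"] in
      \<open>auto simp: unit_square_def cbox_Pair_eq\<close>)
qed

lemma nn_integral_lborel_pair:
  fixes F :: "'a::euclidean_space \<times> 'b::euclidean_space \<Rightarrow> ennreal"
  assumes "F \<in> borel_measurable borel"
  shows "(\<integral>\<^sup>+z. F z \<partial>lborel) = (\<integral>\<^sup>+x. \<integral>\<^sup>+y. F (x, y) \<partial>lborel \<partial>lborel)"
  using lborel.nn_integral_fst[of F lborel] assms by (simp add: lborel_prod)

text \<open>The bound on the fibre over \<open>x\<close> is integrated over the unit square, whose translates by
integer points tile the plane.\<close>

lemma zak_norm_le:
  assumes [measurable]: "g \<in> borel_measurable borel"
    and [measurable]: "(\<lambda>z. zak g (fst z) (snd z)) \<in> borel_measurable borel"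
  shows "(\<integral>\<^sup>+z\<in>phase_square. ennreal ((norm (zak g (fst z) (snd z)))\<^sup>2) \<partial>lborel)
    \<le> (\<integral>\<^sup>+x. ennreal ((norm (g x))\<^sup>2) \<partial>lborel)"
proof -
  define e where "e = from_nat_into Z2"
  let ?B = "box (0, 0) (1, 1) :: (real \<times> real) set"
  have "(\<integral>\<^sup>+z\<in>phase_square. ennreal ((norm (zak g (fst z) (snd z)))\<^sup>2) \<partial>lborel)
     = (\<integral>\<^sup>+x. \<integral>\<^sup>+w. ennreal ((norm (zak g x w))\<^sup>2) * indicator phase_square (x, w) \<partial>lborel \<partial>lborel)"
    by (subst nn_integral_lborel_pair)
      (auto intro!: borel_measurable_times_ennreal borel_measurable_indicator)
  also have "\<dots> = (\<integral>\<^sup>+x\<in>unit_square. (\<integral>\<^sup>+w\<in>unit_square. ennreal ((norm (zak g x w))\<^sup>2) \<partial>lborel) \<partial>lborel)"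
    by (intro nn_integral_cong) (auto simp: indicator_def)
  also have "\<dots> \<le> (\<integral>\<^sup>+x\<in>unit_square. (\<Sum>k. ennreal ((norm (g (x - e k)))\<^sup>2)) \<partial>lborel)"
    unfolding e_def by (intro nn_integral_mono mult_right_mono zak_fibre_norm_le) auto
  also have "\<dots> = (\<integral>\<^sup>+x. (\<Sum>k. ennreal ((norm (g (x - e k)))\<^sup>2) * indicator ?B x) \<partial>lborel)"
    by (rule nn_integral_cong_AE, use AE_unit_square_iff_box in eventually_elim) (auto simp: indicator_def)
  also have "\<dots> = (\<Sum>k. \<integral>\<^sup>+x. ennreal ((norm (g (x - e k)))\<^sup>2) * indicator ?B x \<partial>lborel)"
    by (rule nn_integral_suminf) measurable
  also have "\<dots> = (\<Sum>k. \<integral>\<^sup>+y. ennreal ((norm (g y))\<^sup>2) * indicator ?B (y + e k) \<partial>lborel)"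
  proof (rule suminf_cong)
    show "(\<integral>\<^sup>+x. ennreal ((norm (g (x - e k)))\<^sup>2) * indicator ?B x \<partial>lborel)
        = (\<integral>\<^sup>+y. ennreal ((norm (g y))\<^sup>2) * indicator ?B (y + e k) \<partial>lborel)" for k
      by (subst nn_integral_lborel_translate[of _ "e k"]) (auto simp: add.commute)
  qed
  also have "\<dots> = (\<integral>\<^sup>+y. (\<Sum>k. ennreal ((norm (g y))\<^sup>2) * indicator ?B (y + e k)) \<partial>lborel)"
    by (rule nn_integral_suminf[symmetric]) measurable
  also have "\<dots> = (\<integral>\<^sup>+y. ennreal ((norm (g y))\<^sup>2) * (\<Sum>k. indicator ?B (y + e k)) \<partial>lborel)"
    by (simp add: ennreal_suminf_cmult)
  also have "\<dots> \<le> (\<integral>\<^sup>+y. ennreal ((norm (g y))\<^sup>2) * 1 \<partial>lborel)"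
    unfolding e_def by (intro nn_integral_mono mult_left_mono sum_indicator_translates_le_1) auto
  finally show ?thesis by simp
qed

section \<open>Summability of integer translates and linearity of the Zak transform\<close>

text \<open>For a continuous function the essential supremum over a closed tile is an upper bound at every
point: a larger value would persist on an open set that meets the interior of the tile, and such a
set has positive measure.\<close>

lemma norm_le_esssup_tile:
  fixes f :: "real \<times> real \<Rightarrow> quat"
  assumes f: "continuous_on UNIV f" and y: "y - n \<in> unit_square"
  shows "ennreal (norm (f y)) \<le> esssup lborel (\<lambda>x. ennreal (norm (indicator unit_square (x - n) *\<^sub>R f x)))"
    (is "_ \<le> ?S")
proof (rule ccontr)
  assume "\<not> ?thesis"
  then have less: "?S < ennreal (norm (f y))" by simp
  define U where "U = {x. ?S < ennreal (norm (f x))} \<inter> (\<lambda>x. x - n) -` box (0, 0) (1, 1)"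
  have op: "open {x. ?S < ennreal (norm (f x))}"
    by (intro open_Collect_less continuous_intros continuous_on_ennreal f)
  have "open U"
    unfolding U_def by (intro open_Int op open_vimage open_box continuous_intros)
  have "y - n \<in> closure (box (0, 0) (1, 1))"
    using y by (subst closure_box) (auto simp: unit_square_cbox box_eq_empty Basis_prod_def)
  moreover define V where "V = (\<lambda>z. z + n) -` {x. ?S < ennreal (norm (f x))}"
  moreover have "open V"
    unfolding V_def by (intro op open_vimage continuous_intros)
  moreover have "y - n \<in> V"
    using less by (simp add: V_def)
  ultimately have "V \<inter> box (0, 0) (1, 1) \<noteq> {}"
    by (metis open_Int_closure_eq_empty disjoint_iff)
  then obtain z where "z \<in> box (0, 0) (1, 1)" "?S < ennreal (norm (f (z + n)))"
    by (auto simp: V_def)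
  then have "z + n \<in> U" by (simp add: U_def)
  have "AE x in lborel. x \<notin> U"
    using esssup_AE[of "\<lambda>x. ennreal (norm (indicator unit_square (x - n) *\<^sub>R f x))" lborel]
  proof eventually_elim
    case (elim x)
    then show ?case
      using box_subset_cbox[of "(0, 0)" "(1, 1) :: real \<times> real"]
      by (auto simp: U_def unit_square_cbox not_less indicator_def split: if_splits)
  qed
  then have "U \<in> null_sets lborel"
    using \<open>open U\<close> by (simp add: AE_iff_null_sets)
  then have "negligible U"
    by (simp add: negligible_iff_null_sets null_sets_completionI)
  with \<open>open U\<close> \<open>z + n \<in> U\<close> show False by (metis open_not_negligible emptyE)
qed

text \<open>The points \<open>x - m\<close> lie in pairwise different tiles, so their values are dominated by
different terms of the Wiener norm.\<close>

lemma W0_translates_summable: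
  assumes "f \<in> W0"
  shows "(\<lambda>m. norm (f (x - m))) summable_on Z2"
proof (rule nonneg_bdd_above_summable_on)
  define S where
    "S = (\<lambda>n. esssup lborel (\<lambda>x. ennreal (norm (indicator unit_square (x - n) *\<^sub>R f x))))"
  from assms have "continuous_on UNIV f \<and> wiener_norm f < \<infinity>"
    unfolding W0_def by (rule CollectD)
  then have cont: "continuous_on UNIV f" and fin: "infsum S Z2 < \<infinity>"
    by (simp_all only: wiener_norm_def S_def)
  define b :: "real \<times> real" where "b = (of_int \<lfloor>fst x\<rfloor>, of_int \<lfloor>snd x\<rfloor>)"
  have tile: "x - b \<in> unit_square"
    unfolding b_def unit_square_def mem_Times_iff by (simp; linarith)
  show "bdd_above (sum (\<lambda>m. norm (f (x - m))) ` {F. F \<subseteq> Z2 \<and> finite F})"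
  proof (rule bdd_aboveI2)
    fix F assume F: "F \<in> {F. F \<subseteq> Z2 \<and> finite F}"
    have "ennreal (\<Sum>m\<in>F. norm (f (x - m))) = (\<Sum>m\<in>F. ennreal (norm (f (x - m))))"
      by (simp add: sum_ennreal)
    also have "\<dots> \<le> (\<Sum>m\<in>F. S (b - m))"
      unfolding S_def using tile by (intro sum_mono norm_le_esssup_tile cont) (simp add: algebra_simps)
    also have "\<dots> = sum S ((\<lambda>m. b - m) ` F)"
      by (simp add: sum.reindex inj_on_def)
    also have "\<dots> \<le> infsum S Z2"
      using F by (subst nonneg_infsum_complete) (auto intro!: SUP_upper simp: b_def minus_prod_def)
    finally show "(\<Sum>m\<in>F. norm (f (x - m))) \<le> enn2real (infsum S Z2)"
      using fin enn2real_mono[of "ennreal (\<Sum>m\<in>F. norm (f (x - m)))" "infsum S Z2"]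
      by (simp add: sum_nonneg)
  qed
qed simp

lemma gabor_atom_translates_summable:
  "(\<lambda>m. norm (gabor_atom c l (x - m))) summable_on Z2"
proof -
  obtain p t where l: "l = (p, t)" by (cases l)
  define g where "g y m = exp (- pi * (y - m)\<^sup>2)" for y m :: real
  have "(\<lambda>m. norm c * (g (fst x - fst p) (fst m) * g (snd x - snd p) (snd m))) summable_on Z2"
  proof (intro summable_on_cmult_right summable_on_SigmaI)
    show "((\<lambda>n. g (fst x - fst p) (fst (m, n)) * g (snd x - snd p) (snd (m, n))) has_sum
        g (fst x - fst p) m * infsum (g (snd x - snd p)) \<int>) \<int>" for m
      using gaussian_summable[of "snd x - snd p"]
      by (simp add: g_def[abs_def] has_sum_cmult_right)
    show "(\<lambda>m. g (fst x - fst p) m * infsum (g (snd x - snd p)) \<int>) summable_on \<int>"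
      using gaussian_summable[of "fst x - fst p"]
      by (intro summable_on_cmult_left) (simp add: g_def[abs_def])
  qed (simp add: g_def)
  moreover have "norm (gabor_atom c l (x - m)) =
      norm c * (g (fst x - fst p) (fst m) * g (snd x - snd p) (snd m))" for m
  proof -
    have "(norm (x - m - p))\<^sup>2 = (fst x - fst p - fst m)\<^sup>2 + (snd x - snd p - snd m)\<^sup>2"
    proof -
      have "x - m - p = (fst x - fst p - fst m, snd x - snd p - snd m)"
        by (simp add: prod_eq_iff)
      then show ?thesis by (simp add: norm_prod_def)
    qed
    then have "exp (- pi * (norm (x - m - p))\<^sup>2) = g (fst x - fst p) (fst m) * g (snd x - snd p) (snd m)"
      by (simp only: g_def exp_add distrib_left)
    then show ?thesis
      by (simp add: gabor_atom_def l norm_mult abs_mult) (simp add: g_def)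
  qed
  ultimately show ?thesis by simp
qed

text \<open>The position and frequency are combined into one variable so that each term is a continuous
function on phase space, as needed for joint measurability.\<close>

definition zak_term :: "(real \<times> real \<Rightarrow> quat) \<Rightarrow> real \<times> real \<Rightarrow> phase_point \<Rightarrow> quat" where
  "zak_term g m z = expi (2 * pi * fst m * fst (snd z)) * g (fst z - m) * expj (2 * pi * snd m * snd (snd z))"

lemma zak_eq_infsum_term: "zak g x w = (\<Sum>\<^sub>\<infinity>m\<in>Z2. zak_term g m (x, w))"
  by (simp add: zak_def zak_term_def)

lemma zak_term_summable:
  assumes "\<And>x. (\<lambda>m. norm (g (x - m))) summable_on Z2"
  shows "(\<lambda>m. zak_term g m z) summable_on Z2"
proof (rule abs_summable_summable)
  show "(\<lambda>m. norm (zak_term g m z)) summable_on Z2"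
    using assms[of "fst z"] by (simp add: zak_term_def norm_mult)
qed

lemma zak_measurable:
  assumes "continuous_on UNIV g" "\<And>x. (\<lambda>m. norm (g (x - m))) summable_on Z2"
  shows "(\<lambda>z. zak g (fst z) (snd z)) \<in> borel_measurable borel"
  unfolding zak_eq_infsum_term prod.collapse
proof (rule borel_measurable_infsum_countable[OF countable_Z2 infinite_Z2])
  fix m
  have "continuous_on UNIV (\<lambda>z :: phase_point. g (fst z - m))"
    by (rule continuous_on_compose2[OF assms(1)]) (auto intro!: continuous_intros)
  then have "continuous_on UNIV (zak_term g m)"
    unfolding zak_term_def by (intro continuous_intros)
  then show "zak_term g m \<in> borel_measurable borel"
    by (rule borel_measurable_continuous_onI)
qed (rule zak_term_summable[OF assms(2)])

lemma translates_summable_diff_sum: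
  fixes g :: "real \<times> real \<Rightarrow> quat"
  assumes g: "\<And>x. (\<lambda>m. norm (g (x - m))) summable_on Z2"
    and h: "\<And>l x. l \<in> F \<Longrightarrow> (\<lambda>m. norm (h l (x - m))) summable_on Z2"
    and "finite F"
  shows "(\<lambda>m. norm (g (x - m) - (\<Sum>l\<in>F. h l (x - m)))) summable_on Z2"
proof (rule summable_on_comparison_test)
  have "(\<lambda>m. \<Sum>l\<in>F. norm (h l (x - m))) summable_on Z2"
    using \<open>finite F\<close> h
  proof (induction F)
    case (insert a F)
    then show ?case by (simp add: summable_on_add)
  qed simp
  then show "(\<lambda>m. norm (g (x - m)) + (\<Sum>l\<in>F. norm (h l (x - m)))) summable_on Z2"
    by (intro summable_on_add g)
  show "norm (g (x - m) - (\<Sum>l\<in>F. h l (x - m))) \<le> norm (g (x - m)) + (\<Sum>l\<in>F. norm (h l (x - m)))" for m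
    by (rule order_trans[OF norm_triangle_ineq4 add_left_mono[OF norm_sum]])
qed simp

text \<open>Infinite sums are additive only over summable terms. For the functions in question, the finiteness of
the Wiener norm and Gaussian decay provide this.\<close>

lemma zak_diff_sum:
  assumes g: "\<And>x. (\<lambda>m. norm (g (x - m))) summable_on Z2"
    and h: "\<And>l x. l \<in> F \<Longrightarrow> (\<lambda>m. norm (h l (x - m))) summable_on Z2"
    and "finite F"
  shows "zak (\<lambda>x. g x - (\<Sum>l\<in>F. h l x)) x w = zak g x w - (\<Sum>l\<in>F. zak (h l) x w)"
proof -
  have "((\<lambda>m. \<Sum>l\<in>F. zak_term (h l) m (x, w)) has_sum (\<Sum>l\<in>F. zak (h l) x w)) Z2"
    using \<open>finite F\<close> h
  proof (induction F)
    case (insert a F)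
    then have "((\<lambda>m. zak_term (h a) m (x, w)) has_sum zak (h a) x w) Z2"
      unfolding zak_eq_infsum_term by (intro has_sum_infsum zak_term_summable) auto
    with insert show ?case by (simp add: has_sum_add)
  qed simp
  moreover have "((\<lambda>m. zak_term g m (x, w)) has_sum zak g x w) Z2"
    unfolding zak_eq_infsum_term by (intro has_sum_infsum zak_term_summable g)
  ultimately have "((\<lambda>m. zak_term g m (x, w) + - (\<Sum>l\<in>F. zak_term (h l) m (x, w))) has_sum
      zak g x w + - (\<Sum>l\<in>F. zak (h l) x w)) Z2"
    by (intro has_sum_add has_sum_uminusI)
  moreover have "zak_term g m (x, w) + - (\<Sum>l\<in>F. zak_term (h l) m (x, w))
      = zak_term (\<lambda>x. g x - (\<Sum>l\<in>F. h l x)) m (x, w)" for m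
    by (simp add: zak_term_def sum_distrib_left sum_distrib_right algebra_simps)
  ultimately show ?thesis
    by (simp add: zak_eq_infsum_term infsumI)
qed

section \<open>Zeros of the Zak transform of the Gaussian\<close>

text \<open>The two embeddings of the complex numbers with images \<open>\<real> + i\<real>\<close> and \<open>\<real> + j\<real>\<close>. They reduce both
\<open>zakA\<close> and \<open>zakB\<close> to one complex theta function.\<close>

definition quat_i :: "complex \<Rightarrow> quat" where "quat_i z = Quat (Re z) (Im z) 0 0"
definition quat_j :: "complex \<Rightarrow> quat" where "quat_j z = Quat (Re z) 0 (Im z) 0"

lemma bounded_linear_quat_i: "bounded_linear quat_i" and bounded_linear_quat_j: "bounded_linear quat_j"
  by (intro bounded_linear_intro[where K = 1];
      simp add: quat_i_def quat_j_def plus_quat_def scaleR_quat_def norm_quat_def inner_quat_def cmod_def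
        power2_eq_square)+

lemma quat_i_eq_0_iff: "quat_i z = 0 \<longleftrightarrow> z = 0" and quat_j_eq_0_iff: "quat_j z = 0 \<longleftrightarrow> z = 0"
  by (simp_all add: quat_i_def quat_j_def zero_quat_def complex_eq_iff)

definition theta_term :: "real \<Rightarrow> real \<Rightarrow> complex \<Rightarrow> complex" where
  "theta_term x m w = of_real (exp (- pi * (x - m)\<^sup>2)) * exp (2 * pi * \<i> * of_real m * w)"

text \<open>Completing the square turns the exponential factor into a translate of the Gaussian.\<close>

lemma gaussian_exponential_summable:
  "(\<lambda>m. exp (- pi * (x - m)\<^sup>2 + 2 * pi * R * m)) summable_on (\<int> :: real set)"
proof -
  have "- pi * (x - m)\<^sup>2 + 2 * pi * R * m = pi * ((x + R)\<^sup>2 - x\<^sup>2) + - pi * (x + R - m)\<^sup>2" for m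
    by (simp add: power2_eq_square algebra_simps)
  then have eq: "exp (- pi * (x - m)\<^sup>2 + 2 * pi * R * m) =
      exp (pi * ((x + R)\<^sup>2 - x\<^sup>2)) * exp (- pi * (x + R - m)\<^sup>2)" for m
    by (simp only: exp_add)
  show ?thesis
    unfolding eq by (intro summable_on_cmult_right gaussian_summable)
qed

lemma norm_theta_term_le:
  assumes "norm w \<le> R"
  shows "norm (theta_term x m w)
    \<le> exp (- pi * (x - m)\<^sup>2 + 2 * pi * R * m) + exp (- pi * (x - m)\<^sup>2 + 2 * pi * (- R) * m)"
proof -
  have "\<bar>Im w\<bar> \<le> R" using assms abs_Im_le_cmod[of w] by linarith
  then have "\<bar>m * Im w\<bar> \<le> \<bar>m\<bar> * R"
    unfolding abs_mult by (intro mult_left_mono) auto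
  then have "- (m * Im w) \<le> R * \<bar>m\<bar>"
    by (simp add: mult.commute abs_le_iff)
  then have "2 * pi * (- (m * Im w)) \<le> 2 * pi * (R * \<bar>m\<bar>)"
    by (intro mult_left_mono) auto
  then have "exp (- (2 * pi * m * Im w)) \<le> exp (2 * pi * R * \<bar>m\<bar>)"
    by (simp add: mult.assoc)
  then have "norm (theta_term x m w) \<le> exp (- pi * (x - m)\<^sup>2) * exp (2 * pi * R * \<bar>m\<bar>)"
    by (simp add: theta_term_def norm_mult mult.assoc)
  also have "\<dots> = exp (- pi * (x - m)\<^sup>2 + 2 * pi * R * \<bar>m\<bar>)" by (simp only: exp_add)
  also have "\<dots> \<le> exp (- pi * (x - m)\<^sup>2 + 2 * pi * R * m) + exp (- pi * (x - m)\<^sup>2 + 2 * pi * (- R) * m)"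
    by (cases "m \<ge> 0") (simp_all add: abs_if)
  finally show ?thesis .
qed

lemma theta_bound_summable:
  "(\<lambda>m. exp (- pi * (x - m)\<^sup>2 + 2 * pi * R * m) + exp (- pi * (x - m)\<^sup>2 + 2 * pi * (- R) * m))
    summable_on (\<int> :: real set)"
  by (intro summable_on_add gaussian_exponential_summable)

lemma theta_term_summable: "(\<lambda>m. theta_term x m w) summable_on \<int>"
proof (rule abs_summable_summable, rule summable_on_comparison_test)
  show "norm (theta_term x m w)
      \<le> exp (- pi * (x - m)\<^sup>2 + 2 * pi * norm w * m) + exp (- pi * (x - m)\<^sup>2 + 2 * pi * (- norm w) * m)" for m
    by (rule norm_theta_term_le) simp
qed (rule theta_bound_summable, simp)

text \<open>The Zak transform of the one-dimensional Gaussian with a complex frequency variable, so that the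
identity theorem for holomorphic functions applies.\<close>

definition theta :: "real \<Rightarrow> complex \<Rightarrow> complex" where
  "theta x w = (\<Sum>\<^sub>\<infinity>m\<in>\<int>. theta_term x m w)"

lemma theta_holomorphic: "theta x holomorphic_on UNIV"
proof -
  have "theta x holomorphic_on ball 0 r" for r
  proof -
    have lim: "uniform_limit (cball 0 r) (\<lambda>F w. \<Sum>m\<in>F. theta_term x m w) (theta x) (finite_subsets_at_top \<int>)"
      unfolding theta_def
      by (rule Weierstrass_m_test_general[OF _ theta_bound_summable[of x r]])
        (rule norm_theta_term_le, simp)
    have hol: "\<forall>\<^sub>F F in finite_subsets_at_top \<int>. continuous_on (cball 0 r) (\<lambda>w. \<Sum>m\<in>F. theta_term x m w)
        \<and> (\<lambda>w. \<Sum>m\<in>F. theta_term x m w) holomorphic_on ball 0 r"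
      unfolding theta_term_def
      by (intro always_eventually allI conjI continuous_intros holomorphic_intros)
    show ?thesis
      by (rule holomorphic_uniform_limit[OF hol lim finite_subsets_at_top_neq_bot])
  qed
  then have "\<exists>f'. (theta x has_field_derivative f') (at w)" for w
    using holomorphic_on_open[OF open_ball, of "theta x" 0 "norm w + 1"] by simp
  then show ?thesis
    by (simp add: holomorphic_on_open)
qed

text \<open>At frequency \<open>0\<close> all terms are positive.\<close>

lemma theta_0_nonzero: "theta x 0 \<noteq> 0"
proof -
  have "theta x 0 = of_real (\<Sum>\<^sub>\<infinity>m\<in>\<int>. exp (- pi * (x - m)\<^sup>2))"
    unfolding theta_def theta_term_def
    using has_sum_of_real[OF has_sum_infsum[OF gaussian_summable[of x]]] by (intro infsumI) simp
  moreover have "sum (\<lambda>m. exp (- pi * (x - m)\<^sup>2)) {0} \<le> (\<Sum>\<^sub>\<infinity>m\<in>\<int>. exp (- pi * (x - m)\<^sup>2))"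
    by (rule finite_sum_le_infsum[OF gaussian_summable]) auto
  then have "(\<Sum>\<^sub>\<infinity>m\<in>\<int>. exp (- pi * (x - m)\<^sup>2)) > 0"
    using exp_gt_zero[of "- pi * (x - 0)\<^sup>2"] by (simp del: exp_gt_zero)
  ultimately show ?thesis by simp
qed

lemma theta_zeros_countable: "countable {w. theta x w = 0}"
proof (cases "theta x constant_on UNIV")
  case True
  then have "{w. theta x w = 0} = {}"
    using theta_0_nonzero[of x] by (auto simp: constant_on_def)
  then show ?thesis by simp
next
  case False
  then show ?thesis
    using holomorphic_countable_zeros[OF theta_holomorphic[of x]] by (simp add: connected_UNIV)
qed

lemma theta_real_zeros_countable: "countable {w::real. theta x (of_real w) = 0}"
proof -
  have "of_real ` {w::real. theta x (of_real w) = 0} \<subseteq> {w. theta x w = 0}" by auto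
  then have "countable ((of_real :: real \<Rightarrow> complex) ` {w. theta x (of_real w) = 0})"
    by (rule countable_subset[OF _ theta_zeros_countable])
  then show ?thesis
    by (rule countable_image_inj_on) (simp add: inj_on_def)
qed

lemma of_real_mult_commute_quat: "of_real r * (q :: quat) = q * of_real r"
  by (simp add: of_real_def)

lemma of_real_left_commute_quat: "q * (of_real r * s) = of_real r * (q * s :: quat)"
  by (simp add: of_real_def)

lemma zakA_0_eq_theta: "zakA ((0, 0), (0, 0)) x w = quat_i (theta x (of_real w))"
proof -
  have "((\<lambda>m. quat_i (theta_term x m (of_real w))) has_sum quat_i (theta x (of_real w))) \<int>"
    unfolding theta_def
    by (rule has_sum_bounded_linear[OF bounded_linear_quat_i has_sum_infsum[OF theta_term_summable]])
  moreover have "quat_i (theta_term x m (of_real w)) = expi (2 * pi * m * w) * of_real (exp (- pi * (x - m)\<^sup>2))" for m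
    by (simp add: theta_term_def quat_i_def expi_Quat of_real_quat times_quat_def exp_eq_polar algebra_simps Re_exp Im_exp)
  ultimately show ?thesis
    by (simp add: zakA_def infsumI)
qed

lemma zakB_0_eq_theta: "zakB ((0, 0), (0, 0)) x w = quat_j (theta x (of_real w))"
proof -
  have "((\<lambda>m. quat_j (theta_term x m (of_real w))) has_sum quat_j (theta x (of_real w))) \<int>"
    unfolding theta_def
    by (rule has_sum_bounded_linear[OF bounded_linear_quat_j has_sum_infsum[OF theta_term_summable]])
  moreover have "quat_j (theta_term x m (of_real w)) = of_real (exp (- pi * (x - m)\<^sup>2)) * expj (2 * pi * m * w)" for m
    by (simp add: theta_term_def quat_j_def expj_Quat of_real_quat times_quat_def algebra_simps Re_exp Im_exp)
  ultimately show ?thesis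
    by (simp add: zakB_def infsumI)
qed

lemma bij_betw_translate_Ints: "p \<in> \<int> \<Longrightarrow> bij_betw (\<lambda>m. m - p) \<int> (\<int> :: real set)"
  by (rule bij_betwI[where g = "\<lambda>m. m + p"]) auto

text \<open>Shift the summation index by the integer \<open>p\<^sub>1\<close>. What remains of the modulation,
\<open>exp(2\<pi>i \<theta>\<^sub>1(p\<^sub>1 - m))\<close>, is \<open>1\<close> because \<open>\<theta>\<^sub>1\<close> is an integer.\<close>

lemma zakA_lattice:
  assumes "l \<in> Lattice"
  shows "zakA l (fst x) (fst w) = zakA ((0, 0), (0, 0)) (fst x) (fst w) * expi (phase_i l (x, w))"
proof -
  obtain p t where l: "l = (p, t)" by (cases l)
  have Z: "fst p \<in> \<int>" "fst t \<in> \<int>" using assms by (auto simp: Lattice_def l)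
  define T where "T m = expi (2 * pi * m * fst w) * expi (2 * pi * fst t * (fst x - m))
      * of_real (exp (- pi * (fst x - m - fst p)\<^sup>2))" for m
  have "zakA l (fst x) (fst w) = (\<Sum>\<^sub>\<infinity>m\<in>\<int>. T m)"
    by (simp add: zakA_def l T_def)
  also have "\<dots> = (\<Sum>\<^sub>\<infinity>m\<in>\<int>. T (m - fst p))"
    by (rule infsum_reindex_bij_betw[OF bij_betw_translate_Ints[OF Z(1)], symmetric])
  also have "\<dots> = (\<Sum>\<^sub>\<infinity>m\<in>\<int>. expi (2 * pi * m * fst w) * of_real (exp (- pi * (fst x - m)\<^sup>2)) * expi (phase_i l (x, w)))"
  proof (rule infsum_cong)
    fix m :: real assume "m \<in> \<int>"
    have "2 * pi * (m - fst p) * fst w + 2 * pi * fst t * (fst x - (m - fst p))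
        = 2 * pi * m * fst w + (phase_i l (x, w) + 2 * pi * (fst t * (fst p - m)))"
      by (simp add: phase_i_def l algebra_simps)
    then have "expi (2 * pi * (m - fst p) * fst w) * expi (2 * pi * fst t * (fst x - (m - fst p)))
        = expi (2 * pi * m * fst w) * expi (phase_i l (x, w))"
      using \<open>m \<in> \<int>\<close> Z by (simp only: expi_add[symmetric]) (simp only: expi_add expi_int Ints_mult Ints_diff mult_1_right)
    then show "T (m - fst p) =
        expi (2 * pi * m * fst w) * of_real (exp (- pi * (fst x - m)\<^sup>2)) * expi (phase_i l (x, w))"
      by (simp add: T_def mult.assoc of_real_mult_commute_quat)
  qed
  also have "\<dots> = zakA ((0, 0), (0, 0)) (fst x) (fst w) * expi (phase_i l (x, w))"
    by (simp add: infsum_cmult_left' zakA_def)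
  finally show ?thesis .
qed

lemma zakB_lattice:
  assumes "l \<in> Lattice"
  shows "zakB l (snd x) (snd w) = expj (phase_j l (x, w)) * zakB ((0, 0), (0, 0)) (snd x) (snd w)"
proof -
  obtain p t where l: "l = (p, t)" by (cases l)
  have Z: "snd p \<in> \<int>" "snd t \<in> \<int>" using assms by (auto simp: Lattice_def l)
  define T where "T m = of_real (exp (- pi * (snd x - m - snd p)\<^sup>2)) * expj (2 * pi * snd t * (snd x - m))
      * expj (2 * pi * m * snd w)" for m
  have "zakB l (snd x) (snd w) = (\<Sum>\<^sub>\<infinity>m\<in>\<int>. T m)"
    by (simp add: zakB_def l T_def)
  also have "\<dots> = (\<Sum>\<^sub>\<infinity>m\<in>\<int>. T (m - snd p))"
    by (rule infsum_reindex_bij_betw[OF bij_betw_translate_Ints[OF Z(1)], symmetric])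
  also have "\<dots> = (\<Sum>\<^sub>\<infinity>m\<in>\<int>. expj (phase_j l (x, w)) * (of_real (exp (- pi * (snd x - m)\<^sup>2)) * expj (2 * pi * m * snd w)))"
  proof (rule infsum_cong)
    fix m :: real assume "m \<in> \<int>"
    have "2 * pi * snd t * (snd x - (m - snd p)) + 2 * pi * (m - snd p) * snd w
        = phase_j l (x, w) + 2 * pi * m * snd w + 2 * pi * (snd t * (snd p - m))"
      by (simp add: phase_j_def l algebra_simps)
    then have "expj (2 * pi * snd t * (snd x - (m - snd p))) * expj (2 * pi * (m - snd p) * snd w)
        = expj (phase_j l (x, w)) * expj (2 * pi * m * snd w)"
      using \<open>m \<in> \<int>\<close> Z by (simp only: expj_add[symmetric]) (simp only: expj_add expj_int Ints_mult Ints_diff mult_1_right)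
    then show "T (m - snd p) =
        expj (phase_j l (x, w)) * (of_real (exp (- pi * (snd x - m)\<^sup>2)) * expj (2 * pi * m * snd w))"
      by (simp add: T_def mult.assoc of_real_left_commute_quat)
  qed
  also have "\<dots> = expj (phase_j l (x, w)) * zakB ((0, 0), (0, 0)) (snd x) (snd w)"
    by (simp add: infsum_cmult_right' zakB_def)
  finally show ?thesis .
qed

section \<open>Almost everywhere nonvanishing\<close>

text \<open>The factors \<open>A\<close> and \<open>B\<close> belonging to the lattice point \<open>0\<close>, as functions on phase space.\<close>

definition window_i :: "phase_point \<Rightarrow> quat" where
  "window_i z = zakA ((0, 0), (0, 0)) (fst (fst z)) (fst (snd z))"

definition window_j :: "phase_point \<Rightarrow> quat" where
  "window_j z = zakB ((0, 0), (0, 0)) (snd (fst z)) (snd (snd z))"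

lemma zakA_eq_window:
  "l \<in> Lattice \<Longrightarrow> zakA l (fst (fst z)) (fst (snd z)) = window_i z * expi (phase_i l z)"
  using zakA_lattice[of l "fst z" "snd z"] by (simp add: window_i_def)

lemma zakB_eq_window:
  "l \<in> Lattice \<Longrightarrow> zakB l (snd (fst z)) (snd (snd z)) = expj (phase_j l z) * window_j z"
  using zakB_lattice[of l "fst z" "snd z"] by (simp add: window_j_def)

lemma window_zero_iff:
  "window_i z = 0 \<longleftrightarrow> theta (fst (fst z)) (of_real (fst (snd z))) = 0"
  "window_j z = 0 \<longleftrightarrow> theta (snd (fst z)) (of_real (snd (snd z))) = 0"
  by (simp_all add: window_i_def window_j_def zakA_0_eq_theta zakB_0_eq_theta quat_i_eq_0_iff quat_j_eq_0_iff)

lemma window_measurable [measurable]: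
  "window_i \<in> borel_measurable borel" "window_j \<in> borel_measurable borel"
proof -
  define u where "u m z = theta_term (fst (fst z)) m (of_real (fst (snd z)))" for m and z :: phase_point
  define v where "v m z = theta_term (snd (fst z)) m (of_real (snd (snd z)))" for m and z :: phase_point
  have "u m \<in> borel_measurable borel" "v m \<in> borel_measurable borel" for m
    unfolding u_def v_def theta_term_def
    by (intro borel_measurable_continuous_onI continuous_intros)+
  then have *: "(\<lambda>z. theta (fst (fst z)) (of_real (fst (snd z)))) \<in> borel_measurable (borel :: phase_point measure)"
     "(\<lambda>z. theta (snd (fst z)) (of_real (snd (snd z)))) \<in> borel_measurable (borel :: phase_point measure)"
    using borel_measurable_infsum_countable[OF countable_Ints_real infinite_Ints_real, of u borel]
      borel_measurable_infsum_countable[OF countable_Ints_real infinite_Ints_real, of v borel]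
    by (simp_all add: theta_def u_def v_def theta_term_summable)
  have [measurable]: "quat_i \<in> borel_measurable borel" "quat_j \<in> borel_measurable borel"
    by (intro borel_measurable_continuous_onI linear_continuous_on bounded_linear_quat_i bounded_linear_quat_j)+
  show "window_i \<in> borel_measurable borel" "window_j \<in> borel_measurable borel"
    unfolding window_i_def[abs_def] window_j_def[abs_def] zakA_0_eq_theta zakB_0_eq_theta
    using * by measurable
qed

lemma AE_lborel_pairI:
  fixes P :: "'a::euclidean_space \<times> 'b::euclidean_space \<Rightarrow> bool"
  assumes "{z. P z} \<in> sets borel" "AE x in lborel. AE y in lborel. P (x, y)"
  shows "AE z in lborel. P z"
proof -
  have "{z \<in> space (lborel \<Otimes>\<^sub>M lborel). P z} \<in> sets (lborel \<Otimes>\<^sub>M lborel)"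
    unfolding lborel_prod using assms(1) by simp
  from lborel_pair.AE_pair_measure[OF this assms(2)] show ?thesis
    unfolding lborel_prod .
qed

lemma AE_coordinate_notin_countable:
  fixes C :: "real set"
  assumes "countable C"
  shows "AE w in (lborel :: (real \<times> real) measure). fst w \<notin> C"
    and "AE w in (lborel :: (real \<times> real) measure). snd w \<notin> C"
proof -
  have C: "AE t in lborel. t \<notin> C"
    using countable_imp_null_set_lborel[OF assms] by (rule AE_not_in)
  have "C \<in> sets borel"
    using countable_imp_null_set_lborel[OF assms] by (auto dest: null_setsD2)
  then have meas: "{w :: real \<times> real. fst w \<notin> C} \<in> sets borel" "{w :: real \<times> real. snd w \<notin> C} \<in> sets borel"
    using measurable_sets_borel[OF borel_measurable_continuous_onI[OF continuous_on_fst[OF continuous_on_id]], of "- C"]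
      measurable_sets_borel[OF borel_measurable_continuous_onI[OF continuous_on_snd[OF continuous_on_id]], of "- C"]
    by (simp_all add: vimage_def)
  show "AE w in (lborel :: (real \<times> real) measure). fst w \<notin> C"
    by (rule AE_lborel_pairI[OF meas(1)]) (use C in \<open>eventually_elim; simp\<close>)
  show "AE w in (lborel :: (real \<times> real) measure). snd w \<notin> C"
    by (rule AE_lborel_pairI[OF meas(2)]) (use C in simp)
qed

text \<open>For each fixed position the exceptional frequencies lie on countably many lines, so the claim
follows from Fubini.\<close>

lemma AE_window_nonzero: "AE z in lborel. window_i z \<noteq> 0 \<and> window_j z \<noteq> 0"
proof (rule AE_lborel_pairI)
  show "{z. window_i z \<noteq> 0 \<and> window_j z \<noteq> 0} \<in> sets borel"
    by measurable
  show "AE x in lborel. AE w in lborel. window_i (x, w) \<noteq> 0 \<and> window_j (x, w) \<noteq> 0"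
  proof (rule AE_I2)
    fix x :: "real \<times> real"
    show "AE w in lborel. window_i (x, w) \<noteq> 0 \<and> window_j (x, w) \<noteq> 0"
      using AE_coordinate_notin_countable(1)[OF theta_real_zeros_countable[of "fst x"]]
        AE_coordinate_notin_countable(2)[OF theta_real_zeros_countable[of "snd x"]]
      by eventually_elim (simp add: window_zero_iff)
  qed
qed

section \<open>Fourier coefficients under weighted convergence\<close>

definition character_sum :: "(phase_point \<Rightarrow> quat) \<Rightarrow> phase_point set \<Rightarrow> phase_point \<Rightarrow> quat" where
  "character_sum c F z = (\<Sum>l\<in>F. expi (phase_i l z) * c l * expj (phase_j l z))"

lemma continuous_on_character_sum [continuous_intros]: "continuous_on S (character_sum c F)"
  unfolding character_sum_def[abs_def] by (intro continuous_intros)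

lemma character_sum_measurable [measurable]: "character_sum c F \<in> borel_measurable borel"
  by (intro borel_measurable_continuous_onI continuous_intros)

lemma character_sum_coefficient:
  assumes "finite F" "F \<subseteq> Lattice" "k \<in> F"
  shows "has_bochner_integral (restrict_space lborel phase_square)
    (\<lambda>z. expi (- phase_i k z) * character_sum c F z * expj (- phase_j k z)) (c k)"
proof -
  have "has_bochner_integral (restrict_space lborel phase_square)
      (\<lambda>z. \<Sum>l\<in>F. expi (phase_i (l - k) z) * c l * expj (phase_j (l - k) z))
      (\<Sum>l\<in>F. if l = k then c l else 0)"
  proof (rule has_bochner_integral_sum)
    fix l assume "l \<in> F"
    then have "l - k \<in> Lattice" using assms by (auto intro: Lattice_diff)
    then show "has_bochner_integral (restrict_space lborel phase_square)
        (\<lambda>z. expi (phase_i (l - k) z) * c l * expj (phase_j (l - k) z)) (if l = k then c l else 0)"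
      using has_bochner_integral_compact[of phase_square "\<lambda>z. expi (phase_i (l - k) z) * c l * expj (phase_j (l - k) z)"]
        character_integral_phase_space[of "l - k" "c l"]
      by (simp add: phase_square_cbox continuous_intros)
  qed
  moreover have "expi (- phase_i k z) * (expi (phase_i l z) * c l * expj (phase_j l z)) * expj (- phase_j k z)
      = expi (phase_i (l - k) z) * c l * expj (phase_j (l - k) z)" for l z
  proof -
    have "expi (phase_i (l - k) z) = expi (- phase_i k z) * expi (phase_i l z)"
      "expj (phase_j (l - k) z) = expj (phase_j l z) * expj (- phase_j k z)"
      by (simp_all flip: phase_diff expi_add expj_add)
    then show ?thesis by (simp add: mult.assoc)
  qed
  ultimately show ?thesis
    using assms by (simp add: character_sum_def sum_distrib_left sum_distrib_right)
qed

text \<open>On common indices the coefficients cancel, so only the symmetric difference contributes. This gives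
the Cauchy property of the partial sums without ordering the index set.\<close>

lemma character_sum_diff_norm:
  assumes "finite A" "finite B" "A \<subseteq> Lattice" "B \<subseteq> Lattice"
  shows "(\<integral>\<^sup>+z\<in>phase_square. ennreal ((norm (character_sum c A z - character_sum c B z))\<^sup>2) \<partial>lborel)
    = ennreal ((\<Sum>l\<in>A - B. (norm (c l))\<^sup>2) + (\<Sum>l\<in>B - A. (norm (c l))\<^sup>2))"
proof -
  define d where "d l = (if l \<in> A then c l else 0) - (if l \<in> B then c l else 0)" for l
  have "character_sum c A z = character_sum (\<lambda>l. if l \<in> A then c l else 0) (A \<union> B) z" for z
    unfolding character_sum_def using assms by (intro sum.mono_neutral_cong_left) auto
  moreover have "character_sum c B z = character_sum (\<lambda>l. if l \<in> B then c l else 0) (A \<union> B) z" for z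
    unfolding character_sum_def using assms by (intro sum.mono_neutral_cong_left) auto
  ultimately have "character_sum c A z - character_sum c B z = character_sum d (A \<union> B) z" for z
    by (simp only: character_sum_def d_def left_diff_distrib right_diff_distrib sum_subtractf)
  then have "(\<integral>\<^sup>+z\<in>phase_square. ennreal ((norm (character_sum c A z - character_sum c B z))\<^sup>2) \<partial>lborel)
    = ennreal (\<Sum>l\<in>A \<union> B. (norm (d l))\<^sup>2)"
    unfolding character_sum_def using assms by (simp add: Parseval_phase_space)
  also have "(\<Sum>l\<in>A \<union> B. (norm (d l))\<^sup>2) = (\<Sum>l\<in>(A - B) \<union> (B - A). (norm (d l))\<^sup>2)"
    using assms by (intro sum.mono_neutral_right) (auto simp: d_def)
  also have "\<dots> = (\<Sum>l\<in>A - B. (norm (d l))\<^sup>2) + (\<Sum>l\<in>B - A. (norm (d l))\<^sup>2)"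
    using assms by (intro sum.union_disjoint) auto
  also have "\<dots> = (\<Sum>l\<in>A - B. (norm (c l))\<^sup>2) + (\<Sum>l\<in>B - A. (norm (c l))\<^sup>2)"
    by (intro arg_cong2[where f = "(+)"] sum.cong) (auto simp: d_def)
  finally show ?thesis .
qed

lemma summable_tail_eventually_small:
  fixes g :: "'l \<Rightarrow> real"
  assumes "g summable_on X" "\<And>l. l \<in> X \<Longrightarrow> g l \<ge> 0" "\<epsilon> > 0"
  shows "\<forall>\<^sub>F F in finite_subsets_at_top X. \<forall>F'. finite F' \<longrightarrow> F' \<subseteq> X - F \<longrightarrow> sum g F' < \<epsilon>"
proof -
  have "\<forall>\<^sub>F F in finite_subsets_at_top X. infsum g X - \<epsilon> < sum g F"
    using has_sum_infsum[OF assms(1)] \<open>\<epsilon> > 0\<close> unfolding has_sum_def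
    by (intro order_tendstoD(1)) auto
  moreover have "\<forall>\<^sub>F F in finite_subsets_at_top X. finite F \<and> F \<subseteq> X"
    by (rule eventually_finite_subsets_at_top_weakI) auto
  ultimately show ?thesis
  proof eventually_elim
    case (elim F)
    show ?case
    proof (intro allI impI)
      fix F' assume F': "finite F'" "F' \<subseteq> X - F"
      have "sum g F + sum g F' = sum g (F \<union> F')"
        using elim F' by (subst sum.union_disjoint) auto
      also have "\<dots> \<le> infsum g X"
        using elim F' assms by (intro finite_sum_le_infsum) auto
      finally show "sum g F' < \<epsilon>" using elim by linarith
    qed
  qed
qed

text \<open>The pointwise inequality \<open>t \<le> \<delta> + t\<^sup>2 / \<delta>\<close>, integrated. On a finite measure it turns a small
\<open>L\<^sup>2\<close>-norm into a small \<open>L\<^sup>1\<close>-norm.\<close>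

lemma nn_integral_norm_le_of_square:
  assumes "\<delta> > 0" and [measurable]: "h \<in> borel_measurable M"
  shows "(\<integral>\<^sup>+z. ennreal (norm (h z)) \<partial>M)
    \<le> ennreal \<delta> * emeasure M (space M) + ennreal (1 / \<delta>) * (\<integral>\<^sup>+z. ennreal ((norm (h z))\<^sup>2) \<partial>M)"
proof -
  have "norm (h z) \<le> \<delta> + 1 / \<delta> * (norm (h z))\<^sup>2" for z
  proof (cases "norm (h z) \<le> \<delta>")
    case True
    have "0 \<le> 1 / \<delta> * (norm (h z))\<^sup>2" using assms(1) by simp
    with True show ?thesis by linarith
  next
    case False
    then have "\<delta> * norm (h z) \<le> (norm (h z))\<^sup>2"
      by (simp add: power2_eq_square mult_right_mono)
    then have "norm (h z) \<le> 1 / \<delta> * (norm (h z))\<^sup>2"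
      using assms(1) by (simp add: field_simps)
    with assms(1) show ?thesis by linarith
  qed
  then have "(\<integral>\<^sup>+z. ennreal (norm (h z)) \<partial>M) \<le> (\<integral>\<^sup>+z. ennreal \<delta> + ennreal (1 / \<delta>) * ennreal ((norm (h z))\<^sup>2) \<partial>M)"
    using assms(1)
    by (intro nn_integral_mono) (simp flip: ennreal_mult' ennreal_plus add: ennreal_leI)
  also have "\<dots> = ennreal \<delta> * emeasure M (space M) + ennreal (1 / \<delta>) * (\<integral>\<^sup>+z. ennreal ((norm (h z))\<^sup>2) \<partial>M)"
    by (simp add: nn_integral_add nn_integral_cmult)
  finally show ?thesis .
qed

text \<open>The weight \<open>v\<close> may come arbitrarily close to \<open>0\<close>, so the hypothesis does not bound \<open>H\<close> directly. It
identifies \<open>H\<close> as an almost everywhere limit of partial sums, whose distances are bounded by tails of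
\<open>\<Sum> \<bar>\<gamma>\<^sub>l\<bar>\<^sup>2\<close>. Fatou's lemma transfers this bound to \<open>H\<close>.\<close>

lemma Fourier_coefficient_from_weighted_convergence:
  fixes H :: "phase_point \<Rightarrow> quat" and v :: "phase_point \<Rightarrow> real"
  assumes [measurable]: "H \<in> borel_measurable borel" "v \<in> borel_measurable borel"
    and v: "AE z in lborel. v z \<noteq> 0"
    and summable: "(\<lambda>l. (norm (\<gamma> l))\<^sup>2) summable_on Lattice"
    and conv: "((\<lambda>F. \<integral>\<^sup>+z\<in>phase_square. ennreal ((v z * norm (H z - character_sum \<gamma> F z))\<^sup>2) \<partial>lborel)
        \<longlongrightarrow> 0) (finite_subsets_at_top Lattice)"
    and k: "k \<in> Lattice"
  shows "has_bochner_integral (restrict_space lborel phase_square)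
    (\<lambda>z. expi (- phase_i k z) * H z * expj (- phase_j k z)) (\<gamma> k)"
proof -
  define M where "M = restrict_space (lborel :: phase_point measure) phase_square"
  have sp: "phase_square \<inter> space lborel \<in> sets lborel" by simp
  have M_meas: "g \<in> borel_measurable borel \<Longrightarrow> g \<in> borel_measurable M" for g :: "phase_point \<Rightarrow> 'c::topological_space"
    unfolding M_def by (rule measurable_restrict_space1) simp
  have nnM: "(\<integral>\<^sup>+z. g z \<partial>M) = (\<integral>\<^sup>+z\<in>phase_square. g z \<partial>lborel)" for g
    unfolding M_def by (rule nn_integral_restrict_space[OF sp])
  have AEM: "AE z in M. P z" if "AE z in lborel. P z" for P
    using that unfolding M_def by (subst AE_restrict_space_iff) (auto elim: eventually_mono)
  have emM: "emeasure M (space M) = 1"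
    unfolding M_def by (simp add: space_restrict_space emeasure_restrict_space phase_square_cbox
        emeasure_lborel_cbox_eq Basis_prod_def zero_prod_def)
  interpret M: finite_measure M by standard (simp add: emM)
  let ?G = "character_sum \<gamma>"

  \<comment> \<open>A sequence of index sets, not necessarily increasing. Requiring \<open>k \<in> F\<close> makes the \<open>k\<close>-th coefficient of every partial sum equal to \<open>\<gamma> k\<close>.\<close>
  have "\<exists>F. finite F \<and> F \<subseteq> Lattice \<and> k \<in> F \<and>
      (\<integral>\<^sup>+z. ennreal ((v z * norm (H z - ?G F z))\<^sup>2) \<partial>M) < ennreal (1 / Suc n) \<and>
      (\<forall>F'. finite F' \<longrightarrow> F' \<subseteq> Lattice - F \<longrightarrow> (\<Sum>l\<in>F'. (norm (\<gamma> l))\<^sup>2) < 1 / Suc n)" for n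
  proof -
    have "\<forall>\<^sub>F F in finite_subsets_at_top Lattice. finite F \<and> F \<subseteq> Lattice \<and> k \<in> F"
      using k by (auto simp: eventually_finite_subsets_at_top intro!: exI[of _ "{k}"])
    moreover have "\<forall>\<^sub>F F in finite_subsets_at_top Lattice.
        (\<integral>\<^sup>+z. ennreal ((v z * norm (H z - ?G F z))\<^sup>2) \<partial>M) < ennreal (1 / Suc n)"
      unfolding nnM by (rule order_tendstoD(2)[OF conv]) simp
    moreover have "\<forall>\<^sub>F F in finite_subsets_at_top Lattice.
        \<forall>F'. finite F' \<longrightarrow> F' \<subseteq> Lattice - F \<longrightarrow> (\<Sum>l\<in>F'. (norm (\<gamma> l))\<^sup>2) < 1 / Suc n"
      by (rule summable_tail_eventually_small[OF summable]) auto
    ultimately have "\<forall>\<^sub>F F in finite_subsets_at_top Lattice. (finite F \<and> F \<subseteq> Lattice \<and> k \<in> F) \<and>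
      (\<integral>\<^sup>+z. ennreal ((v z * norm (H z - ?G F z))\<^sup>2) \<partial>M) < ennreal (1 / Suc n) \<and>
      (\<forall>F'. finite F' \<longrightarrow> F' \<subseteq> Lattice - F \<longrightarrow> (\<Sum>l\<in>F'. (norm (\<gamma> l))\<^sup>2) < 1 / Suc n)"
      by eventually_elim blast
    from eventually_happens'[OF finite_subsets_at_top_neq_bot this] show ?thesis by blast
  qed
  then obtain F where F_spec: "\<And>n. finite (F n) \<and> F n \<subseteq> Lattice \<and> k \<in> F n \<and>
      (\<integral>\<^sup>+z. ennreal ((v z * norm (H z - ?G (F n) z))\<^sup>2) \<partial>M) < ennreal (1 / Suc n) \<and>
      (\<forall>F'. finite F' \<longrightarrow> F' \<subseteq> Lattice - F n \<longrightarrow> (\<Sum>l\<in>F'. (norm (\<gamma> l))\<^sup>2) < 1 / Suc n)"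
    by (rule someI_ex[THEN that])
  have F: "finite (F n)" "F n \<subseteq> Lattice" "k \<in> F n"
    and close: "(\<integral>\<^sup>+z. ennreal ((v z * norm (H z - ?G (F n) z))\<^sup>2) \<partial>M) < ennreal (1 / Suc n)" for n
    using F_spec[of n] by simp_all
  have tail: "(\<Sum>l\<in>F'. (norm (\<gamma> l))\<^sup>2) < 1 / Suc n" if "finite F'" "F' \<subseteq> Lattice - F n" for n F'
    using F_spec[of n] that by simp

  define u where "u n z = (v z * norm (H z - ?G (F n) z))\<^sup>2" for n z
  have u_meas: "u n \<in> borel_measurable M" for n
    unfolding u_def by (rule M_meas) measurable
  have u_int: "integrable M (u n)" for n
    using less_trans[OF close[of n] ennreal_less_top]
    by (intro integrableI_nonneg u_meas) (simp_all add: u_def)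
  have u_le: "(\<integral>z. norm (u n z) \<partial>M) \<le> 1 / Suc n" for n
  proof -
    have "ennreal (\<integral>z. norm (u n z) \<partial>M) \<le> ennreal (1 / Suc n)"
      using close[of n] u_int[of n] by (subst nn_integral_eq_integral[symmetric]) (auto simp: u_def[abs_def])
    then show ?thesis by simp
  qed
  have u_lim: "(\<lambda>n. \<integral>z. norm (u n z) \<partial>M) \<longlonglongrightarrow> 0"
    by (rule tendsto_sandwich[OF _ _ tendsto_const lim_inverse_n'[THEN LIMSEQ_Suc]])
      (use u_le in \<open>auto intro!: always_eventually\<close>)
  obtain r where r: "strict_mono r" and AEu: "AE z in M. (\<lambda>n. u (r n) z) \<longlonglongrightarrow> 0"
    using tendsto_L1_AE_subseq[of M u, OF u_int u_lim] by blast
  \<comment> \<open>Only here is the weight divided out, pointwise and hence without a lower bound for it.\<close>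
  have AEH: "AE z in M. (\<lambda>n. ?G (F (r n)) z) \<longlonglongrightarrow> H z"
    using AEu AEM[OF v]
  proof eventually_elim
    case (elim z)
    then have "(\<lambda>n. sqrt (u (r n) z) / \<bar>v z\<bar>) \<longlonglongrightarrow> sqrt 0 / \<bar>v z\<bar>"
      by (intro tendsto_divide tendsto_real_sqrt tendsto_const) auto
    moreover have "sqrt (u (r n) z) / \<bar>v z\<bar> = norm (?G (F (r n)) z - H z)" for n
      using elim by (simp add: u_def abs_mult norm_minus_commute)
    ultimately show ?case
      by (simp add: LIM_zero_iff tendsto_norm_zero_iff)
  qed

  \<comment> \<open>Fatou along the subsequence. For \<open>m \<ge> n\<close> both halves of the symmetric difference are tails of size at most \<open>1 / Suc n\<close>.\<close>
  have L2: "(\<integral>\<^sup>+z. ennreal ((norm (H z - ?G (F n) z))\<^sup>2) \<partial>M) \<le> ennreal (2 / Suc n)" for n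
  proof -
    have "(\<integral>\<^sup>+z. ennreal ((norm (H z - ?G (F n) z))\<^sup>2) \<partial>M)
        = (\<integral>\<^sup>+z. liminf (\<lambda>m. ennreal ((norm (?G (F (r m)) z - ?G (F n) z))\<^sup>2)) \<partial>M)"
    proof (rule nn_integral_cong_AE, use AEH in eventually_elim)
      case (elim z)
      have "(\<lambda>m. ennreal ((norm (?G (F (r m)) z - ?G (F n) z))\<^sup>2)) \<longlonglongrightarrow> ennreal ((norm (H z - ?G (F n) z))\<^sup>2)"
        by (intro tendsto_ennrealI tendsto_power tendsto_norm tendsto_diff elim tendsto_const)
      from lim_imp_Liminf[OF sequentially_bot this] show ?case by simp
    qed
    also have "\<dots> \<le> liminf (\<lambda>m. \<integral>\<^sup>+z. ennreal ((norm (?G (F (r m)) z - ?G (F n) z))\<^sup>2) \<partial>M)"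
      by (rule nn_integral_liminf) (rule M_meas, measurable)
    also have "\<dots> \<le> liminf (\<lambda>m. ennreal (2 / Suc n))"
    proof (rule Liminf_mono, rule eventually_sequentiallyI[of n])
      fix m assume "n \<le> m"
      then have "1 / Suc (r m) \<le> 1 / Suc n"
        using seq_suble[OF r, of m] by (intro divide_left_mono) auto
      moreover have "(\<Sum>l\<in>F (r m) - F n. (norm (\<gamma> l))\<^sup>2) < 1 / Suc n"
        "(\<Sum>l\<in>F n - F (r m). (norm (\<gamma> l))\<^sup>2) < 1 / Suc (r m)"
        using F(1)[of n] F(1)[of "r m"] F(2)[of n] F(2)[of "r m"] by (intro tail; blast)+
      ultimately have "(\<Sum>l\<in>F (r m) - F n. (norm (\<gamma> l))\<^sup>2) + (\<Sum>l\<in>F n - F (r m). (norm (\<gamma> l))\<^sup>2) \<le> 2 / Suc n"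
        by linarith
      then show "(\<integral>\<^sup>+z. ennreal ((norm (?G (F (r m)) z - ?G (F n) z))\<^sup>2) \<partial>M) \<le> ennreal (2 / Suc n)"
        unfolding nnM by (subst character_sum_diff_norm) (auto intro!: F ennreal_leI)
    qed
    finally show ?thesis by (simp add: Liminf_const)
  qed

  have L1: "(\<integral>\<^sup>+z. ennreal (norm (H z - ?G (F n) z)) \<partial>M) \<le> ennreal (\<delta> + 1 / \<delta> * (2 / Suc n))"
    if "\<delta> > 0" for n \<delta>
  proof -
    have "(\<integral>\<^sup>+z. ennreal (norm (H z - ?G (F n) z)) \<partial>M)
        \<le> ennreal \<delta> * emeasure M (space M) + ennreal (1 / \<delta>) * (\<integral>\<^sup>+z. ennreal ((norm (H z - ?G (F n) z))\<^sup>2) \<partial>M)"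
      by (rule nn_integral_norm_le_of_square[OF that]) (rule M_meas, measurable)
    also have "\<dots> \<le> ennreal \<delta> * 1 + ennreal (1 / \<delta>) * ennreal (2 / Suc n)"
      unfolding emM by (intro add_mono mult_left_mono L2) auto
    also have "\<dots> = ennreal (\<delta> + 1 / \<delta> * (2 / Suc n))"
      using that by (simp flip: ennreal_mult' ennreal_plus)
    finally show ?thesis .
  qed

  define E where "E h z = expi (- phase_i k z) * h z * expj (- phase_j k z)" for h z
  have norm_E: "norm (E h z) = norm (h z)" for h z
    by (simp add: E_def norm_mult)
  have E_meas: "E h \<in> borel_measurable M" if [measurable]: "h \<in> borel_measurable borel" for h
    unfolding E_def by (rule M_meas) measurable
  have G: "has_bochner_integral M (E (?G (F n))) (\<gamma> k)" for n
    using character_sum_coefficient[OF F(1,2,3)] by (simp add: M_def E_def[abs_def])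
  have diff_int: "integrable M (E (\<lambda>z. H z - ?G (F n) z))" for n
    using le_less_trans[OF L1[OF zero_less_one, of n]]
    by (intro integrableI_bounded E_meas) (auto simp: norm_E)
  have H_eq: "E H = (\<lambda>z. E (\<lambda>z. H z - ?G (F n) z) z + E (?G (F n)) z)" for n
    by (simp add: E_def fun_eq_iff algebra_simps)
  have int: "integrable M (E H)"
    by (subst H_eq[of 0]) (rule Bochner_Integration.integrable_add[OF diff_int integrable.intros[OF G]])
  \<comment> \<open>The error is at most the \<open>L\<^sup>1\<close>-distance from \<open>H\<close> to a partial sum. First \<open>n \<rightarrow> \<infinity>\<close>, then \<open>\<delta> \<rightarrow> 0\<close>.\<close>
  have "norm ((\<integral>z. E H z \<partial>M) - \<gamma> k) \<le> \<delta>" if "\<delta> > 0" for \<delta>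
  proof (rule LIMSEQ_le_const)
    have "(\<lambda>n. 2 / real (Suc n)) \<longlonglongrightarrow> 0"
      by (rule LIMSEQ_Suc[OF lim_const_over_n])
    from tendsto_add[OF tendsto_const tendsto_mult[OF tendsto_const this], of \<delta> "1 / \<delta>"]
    show "(\<lambda>n. \<delta> + 1 / \<delta> * (2 / Suc n)) \<longlonglongrightarrow> \<delta>"
      by simp
    have "norm ((\<integral>z. E H z \<partial>M) - \<gamma> k) \<le> \<delta> + 1 / \<delta> * (2 / Suc n)" for n
    proof -
      have "(\<integral>z. E H z \<partial>M) - \<gamma> k = (\<integral>z. E (\<lambda>z. H z - ?G (F n) z) z \<partial>M)"
        unfolding H_eq[of n] using G[of n] diff_int[of n]
        by (subst Bochner_Integration.integral_add) (auto simp: has_bochner_integral_iff)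
      then have "norm ((\<integral>z. E H z \<partial>M) - \<gamma> k) \<le> (\<integral>z. norm (E (\<lambda>z. H z - ?G (F n) z) z) \<partial>M)"
        using integral_norm_bound[of M "E (\<lambda>z. H z - ?G (F n) z)"] by simp
      moreover have "ennreal (\<integral>z. norm (E (\<lambda>z. H z - ?G (F n) z) z) \<partial>M) \<le> ennreal (\<delta> + 1 / \<delta> * (2 / Suc n))"
        using L1[OF that, of n] integrable_norm[OF diff_int[of n]]
        by (subst nn_integral_eq_integral[symmetric]) (auto simp: norm_E)
      then have "(\<integral>z. norm (E (\<lambda>z. H z - ?G (F n) z) z) \<partial>M) \<le> \<delta> + 1 / \<delta> * (2 / Suc n)"
        by (rule iffD1[OF ennreal_le_iff, rotated]) (use that in simp)
      ultimately show ?thesis by (rule order_trans)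
    qed
    then show "\<exists>N. \<forall>n\<ge>N. norm ((\<integral>z. E H z \<partial>M) - \<gamma> k) \<le> \<delta> + 1 / \<delta> * (2 / Suc n)" by blast
  qed
  then have "norm ((\<integral>z. E H z \<partial>M) - \<gamma> k) \<le> 0"
    by (rule field_le_epsilon) simp
  with int show ?thesis
    by (simp add: has_bochner_integral_iff M_def E_def[abs_def])
qed

section \<open>The coefficient formula\<close>

lemma f_sharp_translates_summable:
  assumes "f \<in> W0"
  shows "(\<lambda>m. norm (f_sharp f (x - m))) summable_on Z2"
  using translates_summable_diff_sum[of f "{sharp}" "\<lambda>l. gabor_atom (gamma_sharp f) l" x]
    W0_translates_summable[OF assms] gabor_atom_translates_summable
  by (simp add: f_sharp_def)

lemma continuous_on_gabor_atom: "continuous_on S (gabor_atom c l)"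
  unfolding gabor_atom_def[abs_def] by (cases l) (auto intro!: continuous_intros)

lemma continuous_on_f_sharp: "f \<in> W0 \<Longrightarrow> continuous_on UNIV (f_sharp f)"
  unfolding f_sharp_def[abs_def] W0_def
  by (auto intro!: continuous_on_diff continuous_on_gabor_atom)

theorem corollary1:
  fixes f :: "real \<times> real \<Rightarrow> quat" and \<gamma> :: "phase_point \<Rightarrow> quat"
  assumes "f \<in> W0"
    and "relaxed_gabor_expansion f \<gamma>"
  shows "\<forall>l\<in>Lattice.
    (AE (x, \<omega>) in lborel. zakA l (fst x) (fst \<omega>) \<noteq> 0 \<and> zakB l (snd x) (snd \<omega>) \<noteq> 0) \<and>
    set_integrable lborel (unit_square \<times> unit_square)
      (\<lambda>(x, \<omega>). zak_quotient (f_sharp f) l x \<omega>) \<and>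
    \<gamma> l = (LINT \<omega>:unit_square|lborel. LINT x:unit_square|lborel. zak_quotient (f_sharp f) l x \<omega>)"
proof
  fix k assume k: "k \<in> Lattice"
  define Z where "Z z = zak (f_sharp f) (fst z) (snd z)" for z
  define H where "H z = inverse (window_i z) * Z z * inverse (window_j z)" for z
  define v where "v z = norm (window_i z) * norm (window_j z)" for z
  define res where "res F x = f_sharp f x - (\<Sum>l\<in>F. gabor_atom (\<gamma> l) l x)" for F x
  note f_summable = f_sharp_translates_summable[OF assms(1)]
  have Z_meas [measurable]: "Z \<in> borel_measurable borel"
    unfolding Z_def by (rule zak_measurable[OF continuous_on_f_sharp[OF assms(1)] f_summable])
  have H_meas [measurable]: "H \<in> borel_measurable borel" and v_meas [measurable]: "v \<in> borel_measurable borel"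
    unfolding H_def v_def by measurable
  have nonzero: "AE z in lborel. v z \<noteq> 0"
    using AE_window_nonzero by eventually_elim (simp add: v_def)

  \<comment> \<open>After multiplication by \<open>A\<close> and \<open>B\<close>, the error \<open>H - G\<^sub>F\<close> is the Zak transform of the remainder of the Gabor expansion.\<close>
  have bound: "(\<integral>\<^sup>+z\<in>phase_square. ennreal ((v z * norm (H z - character_sum \<gamma> F z))\<^sup>2) \<partial>lborel)
      \<le> (\<integral>\<^sup>+x. ennreal ((norm (f x - (gabor_atom (gamma_sharp f) sharp x + (\<Sum>l\<in>F. gabor_atom (\<gamma> l) l x))))\<^sup>2) \<partial>lborel)"
    if F: "finite F" "F \<subseteq> Lattice" for F
  proof -
    have zak_res: "zak (res F) (fst z) (snd z) = Z z - window_i z * character_sum \<gamma> F z * window_j z" for z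
    proof -
      have "zak (res F) (fst z) (snd z) = Z z - (\<Sum>l\<in>F. zak (gabor_atom (\<gamma> l) l) (fst z) (snd z))"
        unfolding res_def Z_def
        by (rule zak_diff_sum[OF f_summable gabor_atom_translates_summable F(1)])
      also have "(\<Sum>l\<in>F. zak (gabor_atom (\<gamma> l) l) (fst z) (snd z))
          = window_i z * character_sum \<gamma> F z * window_j z"
        unfolding character_sum_def sum_distrib_left sum_distrib_right
        using F by (intro sum.cong refl)
          (auto simp: zak_gabor_atom zakA_eq_window zakB_eq_window mult.assoc)
      finally show ?thesis .
    qed
    have cont: "continuous_on UNIV (res F)"
      unfolding res_def[abs_def]
      by (intro continuous_on_diff continuous_on_sum continuous_on_f_sharp[OF assms(1)] continuous_on_gabor_atom)
    have "(\<integral>\<^sup>+z\<in>phase_square. ennreal ((v z * norm (H z - character_sum \<gamma> F z))\<^sup>2) \<partial>lborel)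
        = (\<integral>\<^sup>+z\<in>phase_square. ennreal ((norm (zak (res F) (fst z) (snd z)))\<^sup>2) \<partial>lborel)"
    proof (rule nn_integral_cong_AE, use AE_window_nonzero in eventually_elim)
      case (elim z)
      then have "Z z = window_i z * H z * window_j z"
        by (simp add: H_def mult.assoc) (simp flip: mult.assoc)
      then have "zak (res F) (fst z) (snd z) = window_i z * (H z - character_sum \<gamma> F z) * window_j z"
        by (simp add: zak_res algebra_simps)
      then show ?case by (simp add: v_def norm_mult mult_ac)
    qed
    also have "\<dots> \<le> (\<integral>\<^sup>+x. ennreal ((norm (res F x))\<^sup>2) \<partial>lborel)"
    proof (rule zak_norm_le)
      show "res F \<in> borel_measurable borel"
        by (rule borel_measurable_continuous_onI[OF cont])
      show "(\<lambda>z. zak (res F) (fst z) (snd z)) \<in> borel_measurable borel"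
        unfolding zak_res by measurable
    qed
    also have "\<dots> = (\<integral>\<^sup>+x. ennreal ((norm (f x - (gabor_atom (gamma_sharp f) sharp x + (\<Sum>l\<in>F. gabor_atom (\<gamma> l) l x))))\<^sup>2) \<partial>lborel)"
      by (simp add: res_def f_sharp_def diff_diff_eq)
    finally show ?thesis .
  qed
  have "((\<lambda>F. \<integral>\<^sup>+z\<in>phase_square. ennreal ((v z * norm (H z - character_sum \<gamma> F z))\<^sup>2) \<partial>lborel)
      \<longlongrightarrow> 0) (finite_subsets_at_top Lattice)"
  proof (rule tendsto_sandwich[OF _ _ tendsto_const])
    show "((\<lambda>F. \<integral>\<^sup>+x. ennreal ((norm (f x - (gabor_atom (gamma_sharp f) sharp x
        + (\<Sum>l\<in>F. gabor_atom (\<gamma> l) l x))))\<^sup>2) \<partial>lborel) \<longlongrightarrow> 0) (finite_subsets_at_top Lattice)"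
      using assms(2) unfolding relaxed_gabor_expansion_def by (rule conjunct2)
  qed (auto intro: bound eventually_finite_subsets_at_top_weakI)
  then have main: "has_bochner_integral (restrict_space lborel phase_square)
      (\<lambda>z. expi (- phase_i k z) * H z * expj (- phase_j k z)) (\<gamma> k)"
    using assms(2) k nonzero
    by (intro Fourier_coefficient_from_weighted_convergence[of H v]) (auto simp: relaxed_gabor_expansion_def)
  \<comment> \<open>With \<open>inverse 0 = 0\<close> the identity holds at the zeros of \<open>A\<close> and \<open>B\<close> as well.\<close>
  have quotient: "zak_quotient (f_sharp f) k (fst z) (snd z) = expi (- phase_i k z) * H z * expj (- phase_j k z)" for z
  proof -
    have "inverse (window_i z * expi (phase_i k z)) = expi (- phase_i k z) * inverse (window_i z)"
      by (cases "window_i z = 0") (simp_all add: nonzero_inverse_mult_distrib inverse_expi)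
    moreover have "inverse (expj (phase_j k z) * window_j z) = inverse (window_j z) * expj (- phase_j k z)"
      by (cases "window_j z = 0") (simp_all add: nonzero_inverse_mult_distrib inverse_expj)
    ultimately show ?thesis
      by (simp add: zak_quotient_def zakA_eq_window[OF k] zakB_eq_window[OF k] H_def Z_def mult.assoc)
  qed
  have sp: "phase_square \<inter> space lborel \<in> sets lborel" by simp
  have integrable: "set_integrable lborel phase_square (\<lambda>(x, w). zak_quotient (f_sharp f) k x w)"
    and integral: "(\<integral>z. indicator phase_square z *\<^sub>R zak_quotient (f_sharp f) k (fst z) (snd z) \<partial>lborel) = \<gamma> k"
    using main
    unfolding has_bochner_integral_iff integrable_restrict_space[OF sp] integral_restrict_space[OF sp]
    by (auto simp: quotient set_integrable_def split_beta)
  have "(LINT w:unit_square|lborel. LINT x:unit_square|lborel. zak_quotient (f_sharp f) k x w)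
      = (\<integral>w. \<integral>x. indicator phase_square (x, w) *\<^sub>R zak_quotient (f_sharp f) k x w \<partial>lborel \<partial>lborel)"
    by (simp add: set_lebesgue_integral_def indicator_times mult.commute flip: scaleR_scaleR integral_scaleR_right)
  also have "\<dots> = (\<integral>z. indicator phase_square z *\<^sub>R zak_quotient (f_sharp f) k (fst z) (snd z) \<partial>(lborel \<Otimes>\<^sub>M lborel))"
    using integrable
    by (subst lborel_pair.integral_snd) (simp_all add: set_integrable_def case_prod_unfold lborel_prod)
  also have "\<dots> = \<gamma> k"
    using integral by (simp add: lborel_prod)
  finally have fubini: "\<gamma> k = (LINT w:unit_square|lborel. LINT x:unit_square|lborel. zak_quotient (f_sharp f) k x w)" ..
  have "AE (x, w) in lborel. zakA k (fst x) (fst w) \<noteq> 0 \<and> zakB k (snd x) (snd w) \<noteq> 0"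
    using AE_window_nonzero
  proof eventually_elim
    case (elim z)
    then show ?case
      using zakA_eq_window[OF k, of z] zakB_eq_window[OF k, of z] by (simp add: split_beta)
  qed
  with integrable fubini show "(AE (x, \<omega>) in lborel. zakA k (fst x) (fst \<omega>) \<noteq> 0 \<and> zakB k (snd x) (snd \<omega>) \<noteq> 0) \<and>
    set_integrable lborel phase_square (\<lambda>(x, \<omega>). zak_quotient (f_sharp f) k x \<omega>) \<and>
    \<gamma> k = (LINT \<omega>:unit_square|lborel. LINT x:unit_square|lborel. zak_quotient (f_sharp f) k x \<omega>)"
    by blast
qed

end
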